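(* If $\mathscr{B}\subset\mathbb{N}$ has light tails then $X_\eta$ is the topological support of $\nu_\eta$.
   Context: $\mathbb{N}=\{1,2,\dots\}$. For $\mathscr{B}\subset\mathbb{N}$ let $\mathcal{F}_{\mathscr{B}}:=\mathbb{Z}\setminus\bigcup_{b\in\mathscr{B}}b\mathbb{Z}$; $\eta\in\{0,1\}^{\mathbb{Z}}$ is the characteristic function of $\mathcal{F}_{\mathscr{B}}$. $S$ is the left shift on $\{0,1\}^{\mathbb{Z}}$ (product topology), and $X_\eta$ is the closure of $\{S^m\eta : m\in\mathbb{Z}\}$. Mirsky measure: let $G$ be the closure of $\{(n \bmod b)_{b\in\mathscr{B}} : n\in\mathbb{Z}\}$ in the compact group $\prod_{b\in\mathscr{B}}\mathbb{Z}/b\mathbb{Z}$, let $\mathbb{P}$ be the normalized Haar measure of $G$, and define $\varphi\colon G\to\{0,1\}^{\mathbb{Z}}$ by $\varphi(g)(n)=1$ iff $n\not\equiv -g_b \bmod b$ for all $b\in\mathscr{B}$ (and $0$ otherwise). Then $\nu_\eta:=\varphi_*(\mathbb{P})$, a Borel probability measure on $\{0,1\}^{\mathbb{Z}}$. The upper density of $A\subset\mathbb{Z}$ is $\overline{d}(A)=\limsup_{N\to\infty}\frac1N|A\cap[1,N]|$. $\mathscr{B}$ has light tails if $\lim_{K\to\infty}\overline{d}\left(\bigcup_{b\in\mathscr{B},\,b>K}b\mathbb{Z}\right)=0$. *)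

theory Defs
  imports "HOL-Probability.Probability" "HOL-Algebra.Product_Groups" "HOL-Algebra.Elementary_Groups"
begin

definition multiples :: "nat \<Rightarrow> int set" where
  "multiples b = {m. int b dvd m}"

definition B_free :: "nat set \<Rightarrow> int set" where
  "B_free B = UNIV - (\<Union>b\<in>B. multiples b)"

text \<open>
  Points of \<open>{0,1}\<^sup>\<int>\<close> are functions of type \<^typ>\<open>int \<Rightarrow> bool\<close>, with \<^const>\<open>True\<close> for 1.
  The type \<^typ>\<open>bool\<close> carries the discrete topology and the function type the product topology,
  so \<^const>\<open>closure\<close>, \<^const>\<open>open\<close> and \<^const>\<open>borel\<close> have their intended meaning.
\<close>

definition eta :: "nat set \<Rightarrow> int \<Rightarrow> bool" where
  "eta B = (\<lambda>n. n \<in> B_free B)"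

definition left_shift :: "(int \<Rightarrow> 'a) \<Rightarrow> (int \<Rightarrow> 'a)" where
  "left_shift x = (\<lambda>n. x (n + 1))"

text \<open>The integer power \<open>S\<^sup>m\<close> of the left shift \<open>S\<close>; the lemmas below characterise it.\<close>

definition shift_power :: "int \<Rightarrow> (int \<Rightarrow> 'a) \<Rightarrow> (int \<Rightarrow> 'a)" where
  "shift_power m x = (\<lambda>n. x (n + m))"

lemma shift_power_of_nat: "shift_power (int k) = left_shift ^^ k"
  by (induction k) (auto simp: shift_power_def left_shift_def fun_eq_iff algebra_simps)

lemma bij_left_shift: "bij left_shift"
  by (rule o_bij[of "shift_power (- 1)"]) (auto simp: shift_power_def left_shift_def fun_eq_iff)

lemma shift_power_minus_of_nat: "shift_power (- int k) = inv_into UNIV left_shift ^^ k"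
proof -
  have "inv_into UNIV left_shift = (shift_power (- 1) :: (int \<Rightarrow> 'a) \<Rightarrow> _)"
    by (rule inv_unique_comp) (auto simp: shift_power_def left_shift_def fun_eq_iff)
  moreover have "shift_power (- int k) = (shift_power (- 1) :: (int \<Rightarrow> 'a) \<Rightarrow> _) ^^ k"
  proof (induction k)
    case (Suc k)
    have "shift_power (- int (Suc k)) = (shift_power (- 1) :: (int \<Rightarrow> 'a) \<Rightarrow> _) \<circ> shift_power (- int k)"
      by (auto simp: shift_power_def fun_eq_iff algebra_simps)
    with Suc show ?case by simp
  qed (simp add: shift_power_def fun_eq_iff)
  ultimately show ?thesis by simp
qed

definition X_eta :: "nat set \<Rightarrow> (int \<Rightarrow> bool) set" where
  "X_eta B = closure {shift_power m (eta B) | m. True}"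

text \<open>The compact group \<open>\<Prod>\<^bsub>b\<in>B\<^esub> \<int>/b\<int>\<close>, with residues represented in \<open>{0..<b}\<close>.\<close>

definition residue_group :: "nat set \<Rightarrow> (nat \<Rightarrow> int) monoid" where
  "residue_group B = product_group B integer_mod_group"

definition residue_topology :: "nat set \<Rightarrow> (nat \<Rightarrow> int) topology" where
  "residue_topology B =
     product_topology (\<lambda>b. discrete_topology (carrier (integer_mod_group b))) B"

definition G_carrier :: "nat set \<Rightarrow> (nat \<Rightarrow> int) set" where
  "G_carrier B = residue_topology B closure_of {(\<lambda>b\<in>B. n mod int b) | n. True}"

definition G_group :: "nat set \<Rightarrow> (nat \<Rightarrow> int) monoid" where
  "G_group B = (residue_group B)\<lparr>carrier := G_carrier B\<rparr>"

definition G_topology :: "nat set \<Rightarrow> (nat \<Rightarrow> int) topology" where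
  "G_topology B = subtopology (residue_topology B) (G_carrier B)"

definition Borel_algebra :: "'a topology \<Rightarrow> 'a measure" where
  "Borel_algebra T = sigma (topspace T) {U. openin T U}"

definition is_normalized_Haar :: "('a, 'b) monoid_scheme \<Rightarrow> 'a topology \<Rightarrow> 'a measure \<Rightarrow> bool" where
  "is_normalized_Haar H T P \<longleftrightarrow>
     prob_space P \<and> sets P = sets (Borel_algebra T) \<and>
     (\<forall>g\<in>carrier H. \<forall>A\<in>sets P. emeasure P ((\<lambda>x. g \<otimes>\<^bsub>H\<^esub> x) ` A) = emeasure P A)"

text \<open>
  The normalized Haar measure of a compact group. Regularity is not listed as a separate
  requirement: the measure is only used for compact metrizable groups, where every Borel
  probability measure is regular, so there is exactly one measure as described.
\<close>

definition normalized_Haar :: "('a, 'b) monoid_scheme \<Rightarrow> 'a topology \<Rightarrow> 'a measure" where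
  "normalized_Haar H T = (THE P. is_normalized_Haar H T P)"

definition phi :: "nat set \<Rightarrow> (nat \<Rightarrow> int) \<Rightarrow> (int \<Rightarrow> bool)" where
  "phi B g = (\<lambda>n. \<forall>b\<in>B. n mod int b \<noteq> (- g b) mod int b)"

definition Mirsky_measure :: "nat set \<Rightarrow> (int \<Rightarrow> bool) measure" where
  "Mirsky_measure B = distr (normalized_Haar (G_group B) (G_topology B)) borel (phi B)"

definition topological_support :: "'a::topological_space measure \<Rightarrow> 'a set" where
  "topological_support M = {x. \<forall>U. open U \<and> x \<in> U \<longrightarrow> emeasure M U > 0}"

definition upper_density :: "int set \<Rightarrow> ereal" where
  "upper_density A = limsup (\<lambda>N. ereal (real (card (A \<inter> {1..int N})) / real N))"

definition light_tails :: "nat set \<Rightarrow> bool" where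
  "light_tails B \<longleftrightarrow> (\<lambda>K::nat. upper_density (\<Union>b\<in>{b\<in>B. b > K}. multiples b)) \<longlonglongrightarrow> 0"

end

theory Submission
  imports Defs
begin

text \<open>
  Both sides are closed sets of 0-1 sequences, so each is determined by the finite patterns it shows:
  \<open>X_eta B\<close> by the patterns that occur somewhere in \<open>eta B\<close>, and the support by the patterns that have
  positive Mirsky measure. The theorem says that these are the same patterns.

  The Mirsky measure is first made computable. Let \<open>w\<close> be a sequence of independent digits, the \<open>k\<close>-th
  uniform on \<open>{0..k}\<close>. The partial sums \<open>trunc K w = (\<Sum>k<K. w k * k!)\<close> are uniform on \<open>{0..<K!}\<close> and
  agree modulo \<open>K!\<close> from the \<open>K\<close>-th on, so \<open>w\<close> is a random profinite integer and
  \<open>trunc b w mod b\<close> is its residue modulo \<open>b\<close>. The distribution of the residues is the Haar measure of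
  the group \<open>G\<close>: a cylinder of level \<open>K\<close> fixes the residues modulo all \<open>b \<le> K\<close>; the cylinders of one
  level are translates of each other and form a finite partition, so every normalized Haar measure
  gives them the same measure, and cylinders form a generating \<open>\<inter>\<close>-stable family (\<open>Haar_unique\<close>,
  \<open>odometer_measure_is_Haar\<close>). Consequently the Haar measure of a condition on the residues modulo
  the \<open>b \<le> K\<close> is the density of the \<open>K!\<close>-periodic set of integers that satisfy it (\<open>prob_trunc\<close>).

  If a pattern has positive measure \<open>p\<close>, then for large \<open>K\<close> the integers at which it is shown by the
  \<open>b \<le> K\<close> alone have density above \<open>p / 2\<close>. At such an integer the pattern fails in \<open>eta B\<close> only if
  one of finitely many shifts is a multiple of some \<open>b > K\<close>, and light tails make these
  exceptions too sparse to cover everything (\<open>positive_patterns_occur_in_eta\<close>).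

  Conversely, consider the pattern of \<open>eta B\<close> at \<open>m\<close>. For large \<open>y\<close>, its zeros persist at all integers
  \<open>n\<close> in the progression \<open>m + M * k\<close> with \<open>M = (y!)\<^sup>2\<close>. A one at position \<open>a = m + i\<close> is destroyed
  at \<open>a + M * k\<close> only by some \<open>b\<in>B\<close> that divides \<open>a + M * k\<close> but not \<open>a\<close>. Put \<open>c = gcd b a\<close> and
  \<open>q = b div c\<close>. As \<open>c \<le> \<bar>a\<bar> \<le> y\<close>, a common factor \<open>p > 1\<close> of \<open>q\<close> and \<open>y!\<close> would make \<open>c * p\<close> a
  divisor of \<open>M\<close>, hence of \<open>a\<close> and of \<open>c\<close>, which is absurd. So \<open>q\<close> is coprime to \<open>M\<close>, exceeds \<open>y\<close>, and divides \<open>a + M * k\<close>. By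
  coprimality the density of such \<open>k\<close> for a given \<open>c\<close> is that of the multiples of the \<open>q\<close> in question,
  which is \<open>c\<close> times the density of the multiples of the \<open>c * q\<close>, elements of \<open>B\<close> beyond \<open>y\<close>. As \<open>c \<le> \<bar>a\<bar>\<close> stays bounded while
  \<open>y\<close> grows, light tails make the proportion of destroyed places in the progression less than 1
  (\<open>mean_density_hit_progression\<close>, \<open>eta_patterns_have_positive_measure\<close>).
\<close>

section \<open>Mean densities of periodic sets of integers\<close>

definition periodic :: "nat \<Rightarrow> int set \<Rightarrow> bool" where
  "periodic R S \<longleftrightarrow> (\<forall>n. n + int R \<in> S \<longleftrightarrow> n \<in> S)"

text \<open>
  The density of \<open>S\<close> when \<open>R\<close> is a positive period of \<open>S\<close>. The period is an argument so that finite counts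
  over \<open>{0..<R}\<close> replace limits.
\<close>

definition mean_density :: "nat \<Rightarrow> int set \<Rightarrow> real" where
  "mean_density R S = real (card (S \<inter> {0..<int R})) / real R"

lemma periodic_add_mult:
  assumes "periodic R S"
  shows "n + k * int R \<in> S \<longleftrightarrow> n \<in> S"
proof (induction k rule: int_induct[where k = 0])
  case (step1 i)
  have "n + (i + 1) * int R = (n + i * int R) + int R" by (simp add: algebra_simps)
  then show ?case using assms step1 unfolding periodic_def by metis
next
  case (step2 i)
  have "n + i * int R = (n + (i - 1) * int R) + int R" by (simp add: algebra_simps)
  then show ?case using assms step2 unfolding periodic_def by metis
qed simp

lemma periodic_mod: "periodic R S \<Longrightarrow> n mod int R \<in> S \<longleftrightarrow> n \<in> S"
  using periodic_add_mult[of R S "n mod int R" "n div int R"] by (simp add: mult.commute)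

lemma periodic_mult: "periodic R S \<Longrightarrow> periodic (R * j) S"
  using periodic_add_mult[of R S _ "int j"] by (simp add: periodic_def mult.commute)

lemma mean_density_mono: "S \<subseteq> T \<Longrightarrow> mean_density R S \<le> mean_density R T"
  unfolding mean_density_def by (intro divide_right_mono of_nat_mono card_mono) auto

lemma mean_density_diff:
  "T \<subseteq> S \<Longrightarrow> mean_density R (S - T) = mean_density R S - mean_density R T"
proof -
  assume sub: "T \<subseteq> S"
  have "(S - T) \<inter> {0..<int R} = (S \<inter> {0..<int R}) - (T \<inter> {0..<int R})" by auto
  moreover have "card ((S \<inter> {0..<int R}) - (T \<inter> {0..<int R}))
      = card (S \<inter> {0..<int R}) - card (T \<inter> {0..<int R})"
    using sub by (intro card_Diff_subset) auto
  moreover have "card (T \<inter> {0..<int R}) \<le> card (S \<inter> {0..<int R})"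
    using sub by (intro card_mono) auto
  ultimately show ?thesis by (simp add: mean_density_def of_nat_diff diff_divide_distrib)
qed

lemma mean_density_UN_le:
  "finite J \<Longrightarrow> mean_density R (\<Union>j\<in>J. S j) \<le> (\<Sum>j\<in>J. mean_density R (S j))"
proof -
  assume J: "finite J"
  have "card ((\<Union>j\<in>J. S j) \<inter> {0..<int R}) = card (\<Union>j\<in>J. S j \<inter> {0..<int R})"
    by (rule arg_cong[where f = card]) auto
  also have "\<dots> \<le> (\<Sum>j\<in>J. card (S j \<inter> {0..<int R}))"
    by (rule card_UN_le[OF J])
  finally show ?thesis
    unfolding mean_density_def sum_divide_distrib[symmetric]
    by (intro divide_right_mono) (simp_all flip: of_nat_sum)
qed

lemma card_periodic_multiple:
  assumes "periodic R S"
  shows "card (S \<inter> {0..<int (R * j)}) = j * card (S \<inter> {0..<int R})"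
proof (induction j)
  case (Suc j)
  have split: "S \<inter> {0..<int (R * Suc j)}
      = S \<inter> {0..<int (R * j)} \<union> (\<lambda>n. n + int j * int R) ` (S \<inter> {0..<int R})"
  proof (intro equalityI subsetI)
    fix n assume n: "n \<in> S \<inter> {0..<int (R * Suc j)}"
    show "n \<in> S \<inter> {0..<int (R * j)} \<union> (\<lambda>n. n + int j * int R) ` (S \<inter> {0..<int R})"
    proof (cases "n < int (R * j)")
      case False
      have "n - int j * int R \<in> S"
        using n periodic_add_mult[OF assms, of n "- int j"] by simp
      then show ?thesis
        using n False by (intro UnI2 image_eqI[of _ _ "n - int j * int R"]) (auto simp: algebra_simps)
    qed (use n in auto)
  next
    fix n assume "n \<in> S \<inter> {0..<int (R * j)} \<union> (\<lambda>n. n + int j * int R) ` (S \<inter> {0..<int R})"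
    then show "n \<in> S \<inter> {0..<int (R * Suc j)}"
      using periodic_add_mult[OF assms, of _ "int j"] by (auto simp: algebra_simps)
  qed
  have "card (S \<inter> {0..<int (R * Suc j)})
      = card (S \<inter> {0..<int (R * j)}) + card ((\<lambda>n. n + int j * int R) ` (S \<inter> {0..<int R}))"
    unfolding split by (rule card_Un_disjoint) (auto simp: algebra_simps)
  also have "card ((\<lambda>n. n + int j * int R) ` (S \<inter> {0..<int R})) = card (S \<inter> {0..<int R})"
    by (rule card_image) (auto simp: inj_on_def)
  finally show ?case using Suc by simp
qed simp

lemma mean_density_multiple:
  "periodic R S \<Longrightarrow> j > 0 \<Longrightarrow> mean_density (R * j) S = mean_density R S"
  using card_periodic_multiple[of R S j] by (simp add: mean_density_def)

lemma mean_density_period_unique: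
  assumes "periodic R S" "periodic Q S" "R > 0" "Q > 0"
  shows "mean_density R S = mean_density Q S"
  using mean_density_multiple[OF assms(1,4)] mean_density_multiple[OF assms(2,3)]
  by (simp add: mult.commute)

text \<open>
  Modulo \<open>R\<close> the map \<open>k \<mapsto> a + M * k\<close> permutes the residues, because \<open>M\<close> is a unit. With \<open>M = 1\<close> this is
  translation invariance.
\<close>

lemma mean_density_affine:
  assumes S: "periodic R S" and R: "R > 0" and cop: "coprime M (int R)"
  shows "mean_density R {k. a + M * k \<in> S} = mean_density R S"
proof -
  define f where "f k = (a + M * k) mod int R" for k
  let ?I = "{0..<int R}"
  have inj: "inj_on f ?I"
  proof (rule inj_onI)
    fix k l assume kl: "k \<in> ?I" "l \<in> ?I" "f k = f l"
    then have "int R dvd M * (k - l)"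
      by (simp add: f_def mod_eq_dvd_iff right_diff_distrib)
    then have "int R dvd k - l"
      using cop by (simp add: coprime_commute coprime_dvd_mult_right_iff)
    with kl show "k = l"
      by (metis atLeastLessThan_iff mod_eq_dvd_iff mod_pos_pos_trivial)
  qed
  moreover have "f ` ?I \<subseteq> ?I"
    using R by (auto simp: f_def)
  ultimately have im: "f ` ?I = ?I"
    by (simp add: endo_inj_surj)
  have "S \<inter> ?I = f ` ({k. a + M * k \<in> S} \<inter> ?I)"
  proof -
    have "f k \<in> S \<longleftrightarrow> a + M * k \<in> S" for k
      unfolding f_def by (rule periodic_mod[OF S])
    then have "{k. a + M * k \<in> S} = {k. f k \<in> S}" by simp
    moreover have "S \<inter> f ` ?I = f ` ({k. f k \<in> S} \<inter> ?I)" by auto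
    ultimately show ?thesis by (simp only: im)
  qed
  then have "card (S \<inter> ?I) = card ({k. a + M * k \<in> S} \<inter> ?I)"
    using card_image[OF inj_on_subset[OF inj, of "{k. a + M * k \<in> S} \<inter> ?I"]] by simp
  then show ?thesis by (simp add: mean_density_def)
qed

lemma periodic_affine:
  assumes "periodic R S"
  shows "periodic R {k. a + M * k \<in> S}"
proof -
  have "a + M * (n + int R) = (a + M * n) + M * int R" for n
    by (simp add: algebra_simps)
  then show ?thesis
    by (simp only: periodic_def mem_Collect_eq periodic_add_mult[OF assms]) simp
qed

lemma periodic_dilate:
  assumes "periodic R S" "c > 0"
  shows "periodic (c * R) ((\<lambda>k. int c * k) ` S)"
  unfolding periodic_def
proof safe
  fix n k assume "n + int (c * R) = int c * k" "k \<in> S"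
  then show "n \<in> (\<lambda>k. int c * k) ` S"
    using periodic_add_mult[OF assms(1), of k "-1"]
    by (intro image_eqI[of _ _ "k - int R"]) (auto simp: algebra_simps)
next
  fix k assume "k \<in> S"
  then show "int c * k + int (c * R) \<in> (\<lambda>k. int c * k) ` S"
    using assms(1) unfolding periodic_def
    by (intro image_eqI[of _ _ "k + int R"]) (auto simp: algebra_simps)
qed

lemma mean_density_dilate:
  assumes "c > 0"
  shows "mean_density (c * R) ((\<lambda>k. int c * k) ` S) = mean_density R S / real c"
proof -
  have "(\<lambda>k. int c * k) ` S \<inter> {0..<int (c * R)} = (\<lambda>k. int c * k) ` (S \<inter> {0..<int R})"
    using assms by (auto simp: zero_le_mult_iff)
  moreover have "card ((\<lambda>k. int c * k) ` (S \<inter> {0..<int R})) = card (S \<inter> {0..<int R})"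
    using assms by (intro card_image) (auto simp: inj_on_def)
  ultimately show ?thesis by (simp add: mean_density_def)
qed

lemma mean_density_progression:
  assumes S: "periodic R S" and "c > 0" "R > 0"
  shows "mean_density (c * R) ((\<lambda>k. a + int c * k) ` S) = mean_density R S / real c"
    and "periodic (c * R) ((\<lambda>k. a + int c * k) ` S)"
proof -
  have eq: "(\<lambda>k. a + int c * k) ` S = {n. - a + 1 * n \<in> (\<lambda>k. int c * k) ` S}"
    by (auto intro!: image_eqI)
  show "periodic (c * R) ((\<lambda>k. a + int c * k) ` S)"
    unfolding eq by (intro periodic_affine periodic_dilate assms)
  show "mean_density (c * R) ((\<lambda>k. a + int c * k) ` S) = mean_density R S / real c"
    unfolding eq using assms
    by (subst mean_density_affine) (auto simp: mean_density_dilate intro: periodic_dilate)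
qed

section \<open>Light tails and arithmetic progressions\<close>

definition tail_multiples :: "nat set \<Rightarrow> nat \<Rightarrow> int set" where
  "tail_multiples B K = (\<Union>b\<in>{b\<in>B. b > K}. multiples b)"

text \<open>
  The form in which light tails are used: a bound on counts, which passes to subsets and finite unions
  without any subadditivity of \<open>limsup\<close>.
\<close>

lemma light_tails_eventually:
  assumes "light_tails B" "e > 0"
  obtains K where "\<forall>\<^sub>F N in sequentially.
    real (card (tail_multiples B K \<inter> {1..int N})) \<le> e * real N"
proof -
  have "\<forall>\<^sub>F K in sequentially. upper_density (tail_multiples B K) < ereal e"
    using assms unfolding light_tails_def tail_multiples_def
    by (intro order_tendstoD(2)[where y = 0]) auto
  then obtain K where "upper_density (tail_multiples B K) < ereal e"
    by (auto simp: eventually_sequentially)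
  then have "\<forall>\<^sub>F N in sequentially.
      ereal (real (card (tail_multiples B K \<inter> {1..int N})) / real N) < ereal e"
    unfolding upper_density_def by (rule Limsup_lessD)
  then have "\<forall>\<^sub>F N in sequentially.
      real (card (tail_multiples B K \<inter> {1..int N})) \<le> e * real N"
    using eventually_gt_at_top[of 0]
    by eventually_elim (simp add: divide_less_eq less_imp_le)
  then show ?thesis by (rule that)
qed

lemma tail_multiples_antimono: "K \<le> L \<Longrightarrow> tail_multiples B L \<subseteq> tail_multiples B K"
  by (force simp: tail_multiples_def)

text \<open>
  Counting along the multiples of the period turns an upper bound on counts into one on the density; the
  additive constant \<open>c\<close> absorbs boundary effects of translations.
\<close>

lemma mean_density_le_of_counting:
  fixes S :: "int set" and c e :: real
  assumes S: "periodic R S" and R: "R > 0"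
    and ev: "\<forall>\<^sub>F N in sequentially. real (card (S \<inter> {1..int N})) \<le> e * real N + c"
  shows "mean_density R S \<le> e"
proof (rule ccontr)
  assume "\<not> mean_density R S \<le> e"
  then have gap: "mean_density R S - e > 0" by simp
  have card_eq: "real (card (S \<inter> {1..int (R * j)})) = mean_density R S * real (R * j)" for j
  proof -
    have "mean_density R {k. 1 + 1 * k \<in> S} = mean_density R S"
      by (rule mean_density_affine[OF S R]) simp
    moreover have "mean_density (R * j) {k. 1 + 1 * k \<in> S} * real (R * j)
        = mean_density R {k. 1 + 1 * k \<in> S} * real (R * j)"
      using mean_density_multiple[OF periodic_affine[OF S, of 1 1], of j] by (cases "j = 0") simp_all
    moreover have "mean_density (R * j) {k. 1 + 1 * k \<in> S} * real (R * j)
        = real (card ({k. 1 + 1 * k \<in> S} \<inter> {0..<int (R * j)}))"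
      using R by (cases "j = 0") (simp_all add: mean_density_def)
    moreover have "card ({k. 1 + 1 * k \<in> S} \<inter> {0..<int (R * j)}) = card (S \<inter> {1..int (R * j)})"
      by (rule bij_betw_same_card[of "\<lambda>k. k + 1"], rule bij_betw_byWitness[where f' = "\<lambda>k. k - 1"])
         (auto simp: add.commute)
    ultimately show ?thesis by metis
  qed
  obtain N0 where N0: "\<And>N. N \<ge> N0 \<Longrightarrow> real (card (S \<inter> {1..int N})) \<le> e * real N + c"
    using ev by (auto simp: eventually_sequentially)
  obtain j0 :: nat where j0: "c < real j0 * (mean_density R S - e)"
    using reals_Archimedean3[OF gap] by blast
  define j where "j = max N0 j0"
  have "j \<le> R * j" using R by simp
  then have "N0 \<le> R * j" by (simp add: j_def)
  from N0[OF this] have "(mean_density R S - e) * real (R * j) \<le> c"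
    unfolding card_eq by (simp add: algebra_simps)
  moreover have "real j0 * (mean_density R S - e) \<le> (mean_density R S - e) * real (R * j)"
  proof -
    have "real j0 \<le> real (R * j)" using \<open>j \<le> R * j\<close> by (simp add: j_def del: of_nat_mult)
    then show ?thesis using gap by (metis mult.commute mult_left_mono less_imp_le)
  qed
  ultimately show False using j0 by simp
qed

lemma coprime_fact_imp_greater: "coprime q (fact y) \<Longrightarrow> q > (1::nat) \<Longrightarrow> q > y"
proof (rule ccontr)
  assume q: "coprime q (fact y)" "q > 1" "\<not> q > y"
  then have "q dvd fact y" by (intro dvd_fact) auto
  with q show False by (metis coprime_absorb_left nat_dvd_1_iff_1 not_less_iff_gr_or_eq is_unit_gcd)
qed

text \<open>
  The heart of the matter. When \<open>a\<close> is free of divisors in \<open>B\<close>, every \<open>b\<in>B\<close> that divides some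
  \<open>a + (y!)\<^sup>2 * k\<close> factors as \<open>b = c * q\<close> with \<open>c = gcd b a \<le> A\<close> and \<open>q > y\<close> coprime to \<open>y!\<close>. For fixed
  \<open>c\<close> the residue of \<open>a + (y!)\<^sup>2 * k\<close> modulo such \<open>q\<close> is equidistributed in \<open>k\<close>, so the progression is
  hit as often as the integers are hit by multiples of the \<open>q\<close>; dilating by \<open>c\<close> turns these into
  multiples of elements of \<open>B\<close> above \<open>y\<close> at the price of a factor \<open>c\<close>. The resulting bound does not
  involve \<open>T\<close> or \<open>R\<close>.
\<close>

lemma mean_density_hit_progression:
  fixes a :: int and T :: "nat set"
  assumes B0: "0 \<notin> B" and T: "finite T" "T \<subseteq> B" and free: "\<And>b. b \<in> B \<Longrightarrow> \<not> int b dvd a"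
    and y: "\<bar>a\<bar> \<le> int A" "A \<le> y"
    and R: "R > 0" "\<And>b. b \<in> T \<Longrightarrow> b dvd R"
    and tail: "\<forall>\<^sub>F N in sequentially. real (card (tail_multiples B y \<inter> {1..int N})) \<le> e * real N"
    and e: "e \<ge> 0"
  shows "mean_density R {k. \<exists>b\<in>T. int b dvd a + (fact y)\<^sup>2 * k} \<le> real A * real A * e"
proof -
  define Q where "Q c = {q. coprime q (fact y) \<and> q > 1 \<and> c * q \<in> T}" for c :: nat
  define H where "H c = {k. \<exists>q\<in>Q c. int q dvd a + (fact y)\<^sup>2 * k}" for c
  have Qfin: "finite (Q c)" if "c > 0" for c
    using that by (intro finite_subset[of "Q c" "(\<lambda>b. b div c) ` T"] finite_imageI T)
      (force simp: Q_def)+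
  have T0: "b > 0" if "b \<in> T" for b
    using that B0 T by (metis gr0I subsetD)
  have cover: "{k. \<exists>b\<in>T. int b dvd a + (fact y)\<^sup>2 * k} \<subseteq> (\<Union>c\<in>{1..A}. H c)"
  proof safe
    fix k b assume b: "b \<in> T" "int b dvd a + (fact y)\<^sup>2 * k"
    have bB: "b \<in> B" using b T by auto
    have a0: "a \<noteq> 0" using free[OF bB] by auto
    define c where "c = gcd b (nat \<bar>a\<bar>)"
    have c0: "c > 0" using T0[OF b(1)] by (simp add: c_def)
    have cA: "c \<le> A"
      using a0 y(1) gcd_le2_nat[of "nat \<bar>a\<bar>" b] unfolding c_def by linarith
    have ca: "int c dvd a" by (simp add: c_def)
    obtain q where q: "b = c * q" using gcd_dvd1[of b "nat \<bar>a\<bar>"] unfolding c_def[symmetric] by (elim dvdE)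
    have cf: "c dvd fact y" using cA y c0 by (intro dvd_fact) auto
    have "coprime q (fact y)"
    proof (rule ccontr)
      assume "\<not> coprime q (fact y)"
      then obtain p where p: "p dvd q" "p dvd fact y" "p \<noteq> 1"
        by (metis coprimeI nat_dvd_1_iff_1 is_unit_gcd)
      \<comment> \<open>The square is needed here: one factorial absorbs \<open>c\<close>, the other one \<open>p\<close>.\<close>
      have "c * p dvd (fact y)\<^sup>2" using cf p(2) by (simp add: power2_eq_square mult_dvd_mono)
      then have "int (c * p) dvd (fact y)\<^sup>2"
        by (metis of_nat_dvd_iff of_nat_fact of_nat_power)
      moreover have "int (c * p) dvd a + (fact y)\<^sup>2 * k"
        using b(2) p(1) q by (meson dvd_trans mult_dvd_mono dvd_refl of_nat_dvd_iff)
      ultimately have "int (c * p) dvd a"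
        by (metis dvd_add_left_iff dvd_mult2)
      then have "c * p dvd nat \<bar>a\<bar>" by (metis nat_abs_dvd_iff dvd_abs_iff int_dvd_int_iff int_nat_eq abs_ge_zero)
      moreover have "c * p dvd b" using p(1) q by simp
      ultimately have "c * p dvd c" unfolding c_def by (metis gcd_greatest)
      with c0 p(3) show False by simp
    qed
    moreover have "q > 1"
    proof (rule ccontr)
      assume "\<not> q > 1"
      with T0[OF b(1)] q have "q = 1" by (cases q) auto
      with free[OF bB] ca q show False by simp
    qed
    ultimately have "q \<in> Q c" using b(1) q by (simp add: Q_def)
    moreover have "int q dvd a + (fact y)\<^sup>2 * k"
      using b(2) q by (metis dvd_mult_right of_nat_mult)
    ultimately have "k \<in> H c" unfolding H_def by blast
    then show "k \<in> (\<Union>c\<in>{1..A}. H c)" using cA c0 by auto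
  qed
  have bound: "mean_density R (H c) \<le> real A * e" if c: "c \<in> {1..A}" for c
  proof -
    have c0: "c > 0" using c by simp
    define P where "P = \<Prod>(Q c)"
    define D where "D = {n. \<exists>q\<in>Q c. int q dvd n}"
    have P0: "P > 0" unfolding P_def by (rule prod_pos) (auto simp: Q_def)
    have qP: "q dvd P" if "q \<in> Q c" for q
      unfolding P_def using that Qfin[OF c0] by (rule dvd_prodI[rotated])
    have perD: "periodic M D" if "\<And>q. q \<in> Q c \<Longrightarrow> q dvd M" for M
      unfolding periodic_def D_def using that by (auto simp: dvd_add_left_iff)
    have H_eq: "H c = {k. a + (fact y)\<^sup>2 * k \<in> D}" by (simp add: H_def D_def)
    have perR: "periodic R D"
    proof (rule perD)
      fix q assume "q \<in> Q c"
      then have "c * q dvd R" using R(2) by (simp add: Q_def)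
      then show "q dvd R" by (rule dvd_mult_right)
    qed
    have "coprime (fact y :: nat) P"
      unfolding P_def by (rule prod_coprime_right) (simp add: Q_def coprime_commute)
    then have cop: "coprime ((fact y)\<^sup>2) (int P)"
      by (metis coprime_power_left_iff coprime_int_iff of_nat_fact)
    \<comment> \<open>The period \<open>R\<close> may share factors with \<open>y!\<close>; the product \<open>P\<close> of the \<open>q\<close> does not.\<close>
    have "mean_density R (H c) = mean_density P (H c)"
      unfolding H_eq
      by (intro mean_density_period_unique periodic_affine perR perD[OF qP] R(1) P0)
    also have "\<dots> = mean_density P D"
      unfolding H_eq using P0 qP cop by (intro mean_density_affine perD) auto
    also have "\<dots> = real c * mean_density (c * P) ((\<lambda>k. int c * k) ` D)"
      using mean_density_dilate[OF c0] c0 by simp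
    also have "\<dots> \<le> real c * e"
    proof (rule mult_left_mono)
      have "(\<lambda>k. int c * k) ` D \<subseteq> tail_multiples B y"
      proof safe
        fix n assume "n \<in> D"
        then obtain q where q: "q \<in> Q c" "int q dvd n" by (auto simp: D_def)
        then have "q > y" using coprime_fact_imp_greater by (auto simp: Q_def)
        moreover have "q \<le> c * q" using c0 by simp
        ultimately have "c * q > y" by linarith
        moreover have "c * q \<in> B" using q T by (auto simp: Q_def)
        moreover have "int (c * q) dvd int c * n" using q by simp
        ultimately show "int c * n \<in> tail_multiples B y"
          unfolding tail_multiples_def multiples_def by blast
      qed
      then have "card ((\<lambda>k. int c * k) ` D \<inter> {1..int N}) \<le> card (tail_multiples B y \<inter> {1..int N})" for N
        by (intro card_mono) auto
      then have "\<forall>\<^sub>F N in sequentially. real (card ((\<lambda>k. int c * k) ` D \<inter> {1..int N})) \<le> e * real N + 0"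
        using tail by (rule_tac eventually_mono[OF tail]) (metis add_0_right of_nat_le_iff order_trans)
      then show "mean_density (c * P) ((\<lambda>k. int c * k) ` D) \<le> e"
        using P0 c0
        by (intro mean_density_le_of_counting[where c = 0] periodic_dilate perD[OF qP]) auto
    qed simp
    also have "\<dots> \<le> real A * e" using c e by (intro mult_right_mono) auto
    finally show ?thesis .
  qed
  have "mean_density R {k. \<exists>b\<in>T. int b dvd a + (fact y)\<^sup>2 * k} \<le> mean_density R (\<Union>c\<in>{1..A}. H c)"
    by (rule mean_density_mono[OF cover])
  also have "\<dots> \<le> (\<Sum>c\<in>{1..A}. mean_density R (H c))"
    by (rule mean_density_UN_le) simp
  also have "\<dots> \<le> (\<Sum>c\<in>{1..A}. real A * e)" by (rule sum_mono) (rule bound)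
  finally show ?thesis by simp
qed

section \<open>Random profinite integers from factorial digits\<close>

text \<open>
  By the factorial number system, points of this space are profinite integers. Factorials as place values
  make the residue modulo every \<open>b\<close> depend on the first \<open>b\<close> digits, with no enumeration of \<open>B\<close>.
\<close>

definition digits :: "(nat \<Rightarrow> nat) measure" where
  "digits = PiM UNIV (\<lambda>k. uniform_count_measure {..k})"

definition trunc :: "nat \<Rightarrow> (nat \<Rightarrow> nat) \<Rightarrow> nat" where
  "trunc K w = (\<Sum>k<K. w k * fact k)"

lemma trunc_Suc: "trunc (Suc K) w = trunc K w + w K * fact K"
  by (simp add: trunc_def)

lemma digits_product_prob_space: "product_prob_space (\<lambda>k::nat. uniform_count_measure {..k})"
  unfolding product_prob_space_def product_prob_space_axioms_def product_sigma_finite_def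
  by (auto intro!: prob_space_uniform_count_measure prob_space_imp_sigma_finite)

lemma prob_space_digits: "prob_space digits"
  unfolding digits_def by (intro prob_space_PiM prob_space_uniform_count_measure) auto

lemma space_digits: "space digits = (\<Pi>\<^sub>E k\<in>UNIV. {..k})"
  by (simp add: digits_def space_PiM space_uniform_count_measure)

lemma trunc_less_fact:
  assumes "w \<in> space digits"
  shows "trunc K w < fact K"
proof (induction K)
  case (Suc K)
  have "w K \<le> K" using assms by (auto simp: space_digits PiE_iff)
  then have "w K * fact K \<le> K * fact K" by (rule mult_right_mono) simp
  moreover have "fact (Suc K) = fact K + K * fact K" by simp
  ultimately show ?case using Suc unfolding trunc_Suc by linarith
qed (simp add: trunc_def)

text \<open>
  Uniqueness of factorial expansions: the event \<open>trunc K w = j\<close> prescribes each of the first \<open>K\<close> digits,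
  so that independence gives its probability.
\<close>

lemma trunc_eq_iff_digits:
  assumes "w \<in> space digits"
  shows "trunc K w = j mod fact K \<longleftrightarrow> (\<forall>k<K. w k = (j div fact k) mod Suc k)"
proof (induction K)
  case (Suc K)
  have "j mod fact (Suc K) = fact K * (j div fact K mod Suc K) + j mod fact K"
    using mod_mult2_eq[of j "fact K" "Suc K"] by (simp add: mult.commute)
  moreover have "trunc (Suc K) w = fact K * w K + trunc K w"
    by (simp add: trunc_Suc)
  moreover have "(fact K * a + r = fact K * b + s) \<longleftrightarrow> a = b \<and> r = s"
    if "r < fact K" "s < fact K" for a b r s :: nat
    using that by (metis div_mult_self4 div_less fact_nonzero add_0_right mod_mult_self4 mod_less)
  ultimately have "trunc (Suc K) w = j mod fact (Suc K) \<longleftrightarrow>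
      w K = j div fact K mod Suc K \<and> trunc K w = j mod fact K"
    using trunc_less_fact[OF assms, of K] by simp
  with Suc show ?case by (auto simp: less_Suc_eq)
qed (simp add: trunc_def)

lemma trunc_cong_fact:
  "K \<le> L \<Longrightarrow> trunc L w mod fact K = trunc K w mod fact K"
proof (induction L rule: dec_induct)
  case (step L)
  have "fact K dvd (fact L :: nat)" using step by (intro fact_dvd) auto
  then have "fact K dvd w L * fact L" by simp
  then show ?case using step unfolding trunc_Suc by (metis mod_add_right_eq dvd_eq_mod_eq_0 add_0_right)
qed simp

lemma trunc_dvd_cong:
  assumes "d > 0" "d dvd fact K" "K \<le> L"
  shows "trunc L w mod d = trunc K w mod d"
  using trunc_cong_fact[OF assms(3), of w] assms(2) by (metis mod_mod_cancel)

lemma trunc_mod_eq: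
  assumes "b > 0" "b \<le> K"
  shows "int (trunc K w) mod int b = int (trunc b w) mod int b"
  using trunc_dvd_cong[of b b K w] assms by (simp add: dvd_fact flip: of_nat_mod)

lemma trunc_dvd_iff:
  assumes "b > 0" "b \<le> K"
  shows "int b dvd n + int (trunc K w) \<longleftrightarrow> int b dvd n + int (trunc b w)"
  using trunc_mod_eq[OF assms, of w] by (metis mod_add_right_eq dvd_eq_mod_eq_0)

lemma measurable_trunc [measurable]: "trunc K \<in> measurable digits (count_space UNIV)"
proof -
  have [measurable]: "(\<lambda>w. w k) \<in> measurable digits (count_space UNIV)" for k
  proof -
    have "(\<lambda>w. w k) \<in> measurable digits (uniform_count_measure {..k})"
      unfolding digits_def by measurable
    also have "measurable digits (uniform_count_measure {..k}) = measurable digits (count_space {..k})"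
      by (rule measurable_cong_sets) (simp_all add: sets_uniform_count_measure_count_space)
    finally have "(\<lambda>w. w k) \<in> measurable digits (count_space {..k})" .
    then show ?thesis
      by (rule measurable_compose) simp
  qed
  show ?thesis
  proof (induction K)
    case (Suc K)
    have "(\<lambda>w. trunc K w + i * fact K) \<in> measurable digits (count_space UNIV)" for i
      by (rule measurable_compose[OF Suc measurable_count_space])
    then show ?case
      unfolding trunc_Suc by (rule measurable_compose_countable) measurable
  qed (simp add: trunc_def)
qed

lemma trunc_set [measurable]: "{w \<in> space digits. P (trunc K w)} \<in> sets digits"
  by measurable

lemma prob_trunc_eq:
  assumes j: "j < fact K"
  shows "measure digits {w \<in> space digits. trunc K w = j} = 1 / fact K"
proof -
  interpret product_prob_space "\<lambda>k::nat. uniform_count_measure {..k}" UNIV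
    by (rule digits_product_prob_space)
  have "{w \<in> space digits. trunc K w = j}
      = {w \<in> space digits. \<forall>k<K. w k = (j div fact k) mod Suc k}"
    using trunc_eq_iff_digits[of _ K j] j by (intro Collect_cong conj_cong refl) simp
  also have "\<dots> = prod_emb UNIV (\<lambda>k. uniform_count_measure {..k}) {..<K}
          (\<Pi>\<^sub>E k\<in>{..<K}. {(j div fact k) mod Suc k})"
    by (auto simp: prod_emb_def space_digits space_uniform_count_measure PiE_iff)
  finally have "measure digits {w \<in> space digits. trunc K w = j}
      = (\<Prod>k<K. measure (uniform_count_measure {..k}) {(j div fact k) mod Suc k})"
    unfolding digits_def
    by (simp add: measure_PiM_emb sets_uniform_count_measure mod_Suc_le_divisor)
  also have "\<dots> = (\<Prod>k<K. 1 / real (Suc k))"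
    by (intro prod.cong refl, subst measure_uniform_count_measure) (auto simp: mod_Suc_le_divisor)
  also have "\<dots> = 1 / fact K"
    by (induction K) simp_all
  finally show ?thesis .
qed

text \<open>
  Since \<open>trunc K\<close> is uniform on \<open>{0..<K!}\<close>, the measure of a condition on it is a count of integers.
\<close>

lemma prob_trunc:
  "measure digits {w \<in> space digits. int (trunc K w) \<in> S} = mean_density (fact K) S"
proof -
  interpret prob_space digits by (rule prob_space_digits)
  define J where "J = {j. j < fact K \<and> int j \<in> S}"
  have fin: "finite J" unfolding J_def by simp
  have "{w \<in> space digits. int (trunc K w) \<in> S} = (\<Union>j\<in>J. {w \<in> space digits. trunc K w = j})"
    using trunc_less_fact[of _ K] by (auto simp: J_def)
  moreover have "measure digits (\<Union>j\<in>J. {w \<in> space digits. trunc K w = j})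
      = (\<Sum>j\<in>J. measure digits {w \<in> space digits. trunc K w = j})"
    using fin by (intro finite_measure_finite_Union) (auto simp: disjoint_family_on_def)
  ultimately have "measure digits {w \<in> space digits. int (trunc K w) \<in> S}
      = (\<Sum>j\<in>J. measure digits {w \<in> space digits. trunc K w = j})"
    by simp
  also have "\<dots> = (\<Sum>j\<in>J. 1 / fact K)"
    by (intro sum.cong refl prob_trunc_eq) (simp add: J_def)
  also have "\<dots> = real (card J) / fact K" by simp
  also have "card J = card (int ` J)"
    by (rule card_image[symmetric]) simp
  also have "int ` J = S \<inter> {0..<int (fact K)}"
  proof safe
    fix n assume n: "n \<in> S" "n \<in> {0..<int (fact K)}"
    then show "n \<in> int ` J"
      by (intro image_eqI[of _ _ "nat n"]) (auto simp: J_def nat_less_iff)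
  qed (auto simp: J_def simp del: of_nat_fact)
  finally show ?thesis by (simp add: mean_density_def)
qed

section \<open>The group of residues and its cylinders\<close>

abbreviation residues :: "nat set \<Rightarrow> int \<Rightarrow> nat \<Rightarrow> int" where
  "residues B n \<equiv> (\<lambda>b\<in>B. n mod int b)"

definition agree :: "nat set \<Rightarrow> nat \<Rightarrow> int \<Rightarrow> (nat \<Rightarrow> int) \<Rightarrow> bool" where
  "agree B K n g \<longleftrightarrow> (\<forall>b\<in>B. b \<le> K \<longrightarrow> g b = n mod int b)"

definition cyl :: "nat set \<Rightarrow> nat \<Rightarrow> int \<Rightarrow> (nat \<Rightarrow> int) set" where
  "cyl B K n = {g \<in> G_carrier B. agree B K n g}"

lemma topspace_residue_topology:
  "topspace (residue_topology B) = (\<Pi>\<^sub>E b\<in>B. carrier (integer_mod_group b))"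
  by (simp add: residue_topology_def)

lemma residues_in_topspace: "0 \<notin> B \<Longrightarrow> residues B n \<in> topspace (residue_topology B)"
  by (auto simp: topspace_residue_topology PiE_iff carrier_integer_mod_group pos_mod_bound intro!: gr0I)

text \<open>
  Only finitely many natural numbers are \<open>\<le> K\<close>, so prescribing the coordinates up to \<open>K\<close> is an open
  condition; conversely the next lemma shows that these sets form a neighbourhood base.
\<close>

lemma openin_prescribed_coordinates:
  "openin (residue_topology B)
     {g \<in> topspace (residue_topology B). \<forall>b\<in>B. b \<le> K \<longrightarrow> g b = t b}" (is "openin _ ?S")
  unfolding residue_topology_def openin_product_topology_alt
  unfolding residue_topology_def[symmetric]
proof (intro ballI exI conjI)
  fix g assume g: "g \<in> ?S"
  let ?U = "\<lambda>b. if b \<le> K then {g b} else carrier (integer_mod_group b)"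
  have g_mem: "g \<in> Pi\<^sub>E B (\<lambda>b. carrier (integer_mod_group b))"
    using g by (simp add: topspace_residue_topology)
  have g_eq: "g b = t b" if "b \<in> B" "b \<le> K" for b
    using g that by simp
  show "finite {b \<in> B. ?U b \<noteq> topspace (discrete_topology (carrier (integer_mod_group b)))}"
    by (rule finite_subset[of _ "{..K}"]) auto
  show "openin (discrete_topology (carrier (integer_mod_group b))) (?U b)" if "b \<in> B" for b
    using PiE_mem[OF g_mem that] by simp
  show "g \<in> Pi\<^sub>E B ?U"
    using g_mem by (simp add: PiE_iff)
  show "Pi\<^sub>E B ?U \<subseteq> ?S"
  proof
    fix h assume h: "h \<in> Pi\<^sub>E B ?U"
    have "h b \<in> carrier (integer_mod_group b)" "b \<le> K \<longrightarrow> h b = t b" if "b \<in> B" for b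
      using PiE_mem[OF h that] PiE_mem[OF g_mem that] g_eq[OF that] by (auto split: if_splits)
    then show "h \<in> ?S"
      using h by (simp add: topspace_residue_topology PiE_iff)
  qed
qed

lemma open_residue_contains_agree:
  assumes "openin (residue_topology B) U" "g \<in> U"
  obtains K where "\<And>h. h \<in> topspace (residue_topology B) \<Longrightarrow> (\<And>b. b \<in> B \<Longrightarrow> b \<le> K \<Longrightarrow> h b = g b) \<Longrightarrow> h \<in> U"
proof -
  have "\<exists>V. finite {b \<in> B. V b \<noteq> topspace (discrete_topology (carrier (integer_mod_group b)))}
      \<and> (\<forall>b\<in>B. openin (discrete_topology (carrier (integer_mod_group b))) (V b))
      \<and> g \<in> Pi\<^sub>E B V \<and> Pi\<^sub>E B V \<subseteq> U"
    using assms(1)[unfolded residue_topology_def openin_product_topology_alt, rule_format, OF assms(2)] .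
  then obtain V where V: "finite {b \<in> B. V b \<noteq> topspace (discrete_topology (carrier (integer_mod_group b)))}
      \<and> (\<forall>b\<in>B. openin (discrete_topology (carrier (integer_mod_group b))) (V b))
      \<and> g \<in> Pi\<^sub>E B V \<and> Pi\<^sub>E B V \<subseteq> U"
    by (elim exE) (rule that)
  have V_fin: "finite {b \<in> B. V b \<noteq> carrier (integer_mod_group b)}"
    using conjunct1[OF V] unfolding topspace_discrete_topology .
  have V_mem: "g \<in> Pi\<^sub>E B V" and V_sub: "Pi\<^sub>E B V \<subseteq> U"
    using conjunct2[OF conjunct2[OF V]] by (rule conjunct1, rule conjunct2)
  obtain K where "\<forall>b\<in>{b \<in> B. V b \<noteq> carrier (integer_mod_group b)}. b \<le> K"
    using V_fin unfolding finite_nat_set_iff_bounded_le by (elim exE) (rule that)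
  then have K: "V b = carrier (integer_mod_group b)" if "b \<in> B" "\<not> b \<le> K" for b
    using that by auto
  show ?thesis
  proof (rule that[of K])
    fix h assume h: "h \<in> topspace (residue_topology B)" "\<And>b. b \<in> B \<Longrightarrow> b \<le> K \<Longrightarrow> h b = g b"
    have "h b \<in> V b" if "b \<in> B" for b
    proof (cases "b \<le> K")
      case True
      with h PiE_mem[OF V_mem that] that show ?thesis by simp
    next
      case False
      with K that have "V b = carrier (integer_mod_group b)" by simp
      with h that show ?thesis by (auto simp: topspace_residue_topology PiE_iff)
    qed
    then have "h \<in> Pi\<^sub>E B V" using h by (auto simp: topspace_residue_topology PiE_iff)
    with V_sub show "h \<in> U" by auto
  qed
qed

text \<open>
  Replaces the closure by an approximation property that is visibly compatible with addition and negation.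
\<close>

lemma G_carrier_iff:
  assumes B: "0 \<notin> B"
  shows "g \<in> G_carrier B \<longleftrightarrow> g \<in> topspace (residue_topology B) \<and> (\<forall>K. \<exists>n. agree B K n g)"
proof safe
  assume g: "g \<in> G_carrier B"
  then show top: "g \<in> topspace (residue_topology B)"
    using closure_of_subset_topspace by (fastforce simp: G_carrier_def)
  fix K
  let ?U = "{h \<in> topspace (residue_topology B). \<forall>b\<in>B. b \<le> K \<longrightarrow> h b = g b}"
  have "openin (residue_topology B) ?U"
    by (rule openin_prescribed_coordinates)
  then have U: "g \<in> ?U \<and> openin (residue_topology B) ?U" using top by simp
  have "\<exists>y. y \<in> {residues B n |n. True} \<and> y \<in> ?U"
    using conjunct2[OF g[unfolded G_carrier_def in_closure_of], rule_format, OF U] .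
  then obtain n where "residues B n \<in> ?U"
    by (elim exE conjE CollectE) simp
  then show "\<exists>n. agree B K n g"
    by (intro exI[of _ n]) (auto simp: agree_def)
next
  assume top: "g \<in> topspace (residue_topology B)" and ag: "\<forall>K. \<exists>n. agree B K n g"
  show "g \<in> G_carrier B"
    unfolding G_carrier_def in_closure_of
  proof (intro conjI allI impI top)
    fix U assume U: "g \<in> U \<and> openin (residue_topology B) U"
    obtain K where K: "\<And>h. h \<in> topspace (residue_topology B) \<Longrightarrow> (\<And>b. b \<in> B \<Longrightarrow> b \<le> K \<Longrightarrow> h b = g b) \<Longrightarrow> h \<in> U"
      using open_residue_contains_agree[OF conjunct2[OF U] conjunct1[OF U]] by metis
    obtain n where n: "agree B K n g" using ag by blast
    have "residues B n \<in> U"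
      using n by (intro K residues_in_topspace[OF B]) (simp_all add: agree_def)
    then show "\<exists>h. h \<in> {residues B n |n. True} \<and> h \<in> U" by blast
  qed
qed

lemma mem_pos: "0 \<notin> B \<Longrightarrow> b \<in> B \<Longrightarrow> (b::nat) > 0"
  by (metis gr0I)

lemma agree_residues: "agree B K n (residues B n)"
  by (simp add: agree_def)

lemma residues_in_G: "0 \<notin> B \<Longrightarrow> residues B n \<in> G_carrier B"
  using agree_residues by (auto simp: G_carrier_iff residues_in_topspace)

definition add_residues :: "nat set \<Rightarrow> (nat \<Rightarrow> int) \<Rightarrow> (nat \<Rightarrow> int) \<Rightarrow> nat \<Rightarrow> int" where
  "add_residues B g h = (\<lambda>b\<in>B. (g b + h b) mod int b)"

definition neg_residues :: "nat set \<Rightarrow> (nat \<Rightarrow> int) \<Rightarrow> nat \<Rightarrow> int" where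
  "neg_residues B g = (\<lambda>b\<in>B. (- g b) mod int b)"

lemma carrier_G_group: "carrier (G_group B) = G_carrier B"
  by (simp add: G_group_def)

lemma mult_G_group: "g \<otimes>\<^bsub>G_group B\<^esub> h = add_residues B g h"
  by (simp add: G_group_def residue_group_def add_residues_def)

lemma agree_add: "agree B K m g \<Longrightarrow> agree B K n h \<Longrightarrow> agree B K (m + n) (add_residues B g h)"
  by (simp add: agree_def add_residues_def mod_add_eq)

lemma agree_neg: "agree B K m g \<Longrightarrow> agree B K (- m) (neg_residues B g)"
  by (simp add: agree_def neg_residues_def mod_minus_eq)

lemma add_residues_in_G:
  assumes "0 \<notin> B" "g \<in> G_carrier B" "h \<in> G_carrier B"
  shows "add_residues B g h \<in> G_carrier B"
proof -
  have "add_residues B g h \<in> topspace (residue_topology B)"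
    using residues_in_topspace[OF assms(1), of 0] assms(1)
    by (auto simp: add_residues_def topspace_residue_topology carrier_integer_mod_group intro!: gr0I)
  then show ?thesis
    using assms agree_add by (meson G_carrier_iff)
qed

lemma neg_residues_in_G:
  assumes "0 \<notin> B" "g \<in> G_carrier B"
  shows "neg_residues B g \<in> G_carrier B"
proof -
  have "neg_residues B g \<in> topspace (residue_topology B)"
    using assms(1)
    by (auto simp: neg_residues_def topspace_residue_topology carrier_integer_mod_group intro!: gr0I)
  then show ?thesis
    using assms agree_neg by (meson G_carrier_iff)
qed

lemma G_carrier_mod:
  assumes "0 \<notin> B" "g \<in> G_carrier B" "b \<in> B"
  shows "g b mod int b = g b"
proof -
  have "g b \<in> carrier (integer_mod_group b)" "b \<noteq> 0"
    using assms mem_pos[OF assms(1,3)] by (auto simp: G_carrier_iff topspace_residue_topology)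
  then show ?thesis by (simp add: carrier_integer_mod_group)
qed

lemma G_carrier_ext:
  assumes "0 \<notin> B" "g \<in> G_carrier B" "h \<in> G_carrier B" "\<And>b. b \<in> B \<Longrightarrow> g b = h b"
  shows "g = h"
  using assms by (auto simp: G_carrier_iff topspace_residue_topology intro: PiE_ext)

lemma neg_add_cancel:
  assumes "0 \<notin> B" "g \<in> G_carrier B" "x \<in> G_carrier B"
  shows "add_residues B (neg_residues B g) (add_residues B g x) = x"
    and "add_residues B g (add_residues B (neg_residues B g) x) = x"
proof -
  show "add_residues B (neg_residues B g) (add_residues B g x) = x"
    using assms
    by (intro G_carrier_ext[of B] add_residues_in_G neg_residues_in_G)
      (auto simp: add_residues_def neg_residues_def mod_simps G_carrier_mod)
  show "add_residues B g (add_residues B (neg_residues B g) x) = x"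
    using assms
    by (intro G_carrier_ext[of B] add_residues_in_G neg_residues_in_G)
      (auto simp: add_residues_def neg_residues_def mod_simps G_carrier_mod)
qed

lemma image_add_residues:
  assumes "0 \<notin> B" "g \<in> G_carrier B" "A \<subseteq> G_carrier B"
  shows "add_residues B g ` A = {x \<in> G_carrier B. add_residues B (neg_residues B g) x \<in> A}"
proof (intro equalityI subsetI)
  fix x assume "x \<in> add_residues B g ` A"
  then show "x \<in> {x \<in> G_carrier B. add_residues B (neg_residues B g) x \<in> A}"
    using assms by (auto simp: neg_add_cancel subset_iff intro!: add_residues_in_G)
next
  fix x assume "x \<in> {x \<in> G_carrier B. add_residues B (neg_residues B g) x \<in> A}"
  then show "x \<in> add_residues B g ` A"
    using assms by (intro image_eqI[of _ _ "add_residues B (neg_residues B g) x"]) (auto simp: neg_add_cancel)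
qed

text \<open>
  Translations permute the cylinders of a given level.
\<close>

lemma vimage_add_cyl:
  assumes "0 \<notin> B" "g \<in> G_carrier B" "agree B K m g"
  shows "{x \<in> G_carrier B. add_residues B g x \<in> cyl B K n} = cyl B K (n - m)"
proof -
  have "agree B K n (add_residues B g x) \<longleftrightarrow> agree B K (n - m) x" if x: "x \<in> G_carrier B" for x
  proof
    assume "agree B K n (add_residues B g x)"
    from agree_add[OF agree_neg[OF assms(3)] this]
    show "agree B K (n - m) x" using neg_add_cancel(1)[OF assms(1,2) x] by simp
  next
    assume "agree B K (n - m) x"
    from agree_add[OF assms(3) this] show "agree B K n (add_residues B g x)" by simp
  qed
  then show ?thesis
    using assms by (auto simp: cyl_def add_residues_in_G)
qed

text \<open>
  The empty set is included so that the family is closed under intersections.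
\<close>

definition cylinders :: "nat set \<Rightarrow> (nat \<Rightarrow> int) set set" where
  "cylinders B = insert {} {cyl B K n | K n. True}"

lemma cyl_in_cylinders: "cyl B K n \<in> cylinders B"
  by (auto simp: cylinders_def)

lemma cyl_0: "0 \<notin> B \<Longrightarrow> cyl B 0 n = G_carrier B"
  by (auto simp: cyl_def agree_def)

text \<open>
  Cylinders are nested or disjoint, as balls in an ultrametric space.
\<close>

lemma cyl_Int:
  assumes "K \<le> L"
  shows "cyl B K n \<inter> cyl B L m \<in> {{}, cyl B L m}"
proof (cases "\<forall>b\<in>B. b \<le> K \<longrightarrow> n mod int b = m mod int b")
  case True
  then have "cyl B L m \<subseteq> cyl B K n" using assms by (auto simp: cyl_def agree_def)
  then show ?thesis by auto
next
  case False
  then have "cyl B K n \<inter> cyl B L m = {}" using assms by (fastforce simp: cyl_def agree_def)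
  then show ?thesis by simp
qed

lemma cyl_Int_same: "cyl B K n \<inter> cyl B K m = {} \<or> cyl B K n = cyl B K m"
  using cyl_Int[of K K B n m] cyl_Int[of K K B m n] by auto

lemma Int_stable_cylinders: "Int_stable (cylinders B)"
proof (rule Int_stableI)
  fix a b assume "a \<in> cylinders B" "b \<in> cylinders B"
  then consider "a \<inter> b = {}" | K n L m where "a = cyl B K n" "b = cyl B L m"
    by (auto simp: cylinders_def)
  then show "a \<inter> b \<in> cylinders B"
  proof cases
    case 2
    have "{{}, a, b} \<subseteq> cylinders B" using 2 cyl_in_cylinders by (simp add: cylinders_def)
    moreover have "a \<inter> b \<in> {{}, a, b}"
      using cyl_Int[of K L B n m] cyl_Int[of L K B m n] linear[of K L] 2 by (auto simp only: Int_commute)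
    ultimately show ?thesis by (rule subsetD)
  qed (simp add: cylinders_def)
qed

lemma countable_cylinders: "countable (cylinders B)"
proof -
  have "{cyl B K n | K n. True} = (\<lambda>(K, n). cyl B K n) ` UNIV" by auto
  then show ?thesis unfolding cylinders_def by simp
qed

lemma G_carrier_subset: "G_carrier B \<subseteq> topspace (residue_topology B)"
  unfolding G_carrier_def by (rule closure_of_subset_topspace)

lemma topspace_G_topology: "topspace (G_topology B) = G_carrier B"
  unfolding G_topology_def topspace_subtopology by (rule Int_absorb1[OF G_carrier_subset])

lemma openin_cyl: "openin (G_topology B) (cyl B K n)"
proof -
  have "cyl B K n
      = {g \<in> topspace (residue_topology B). \<forall>b\<in>B. b \<le> K \<longrightarrow> g b = n mod int b} \<inter> G_carrier B"
    unfolding cyl_def agree_def using subsetD[OF G_carrier_subset] by fast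
  then show ?thesis
    unfolding G_topology_def openin_subtopology
    by (intro exI conjI) (rule openin_prescribed_coordinates)
qed

text \<open>
  There are countably many cylinders and they form a base, so they generate the Borel sets.
\<close>

lemma sets_Borel_G: "0 \<notin> B \<Longrightarrow> sets (Borel_algebra (G_topology B)) = sigma_sets (G_carrier B) (cylinders B)"
proof -
  assume B: "0 \<notin> B"
  have sub: "{U. openin (G_topology B) U} \<subseteq> Pow (G_carrier B)"
    using openin_subset topspace_G_topology by fastforce
  have "sigma_sets (G_carrier B) {U. openin (G_topology B) U} = sigma_sets (G_carrier B) (cylinders B)"
  proof (rule sigma_sets_eqI)
    fix U assume "U \<in> {U. openin (G_topology B) U}"
    then obtain V where V: "openin (residue_topology B) V" "U = V \<inter> G_carrier B"
      by (auto simp: G_topology_def openin_subtopology)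
    have "U = \<Union>{D \<in> cylinders B. D \<subseteq> U}"
    proof (intro equalityI subsetI)
      fix g assume g: "g \<in> U"
      with V have gV: "g \<in> V" "g \<in> G_carrier B" by auto
      obtain K where K: "\<And>h. h \<in> topspace (residue_topology B) \<Longrightarrow>
          (\<And>b. b \<in> B \<Longrightarrow> b \<le> K \<Longrightarrow> h b = g b) \<Longrightarrow> h \<in> V"
        using open_residue_contains_agree[OF V(1) gV(1)] by blast
      obtain n where n: "agree B K n g" using gV(2) G_carrier_iff[OF B] by blast
      have "cyl B K n \<subseteq> U"
        using n V(2) G_carrier_iff[OF B] by (auto simp: cyl_def agree_def intro!: K)
      moreover have "g \<in> cyl B K n" using gV n by (simp add: cyl_def)
      ultimately show "g \<in> \<Union>{D \<in> cylinders B. D \<subseteq> U}" using cyl_in_cylinders by blast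
    qed auto
    moreover have "countable {D \<in> cylinders B. D \<subseteq> U}"
      using countable_cylinders by simp
    ultimately show "U \<in> sigma_sets (G_carrier B) (cylinders B)"
      by (metis (no_types, lifting) sigma_sets_UNION sigma_sets.Basic mem_Collect_eq)
  next
    fix D assume "D \<in> cylinders B"
    then show "D \<in> sigma_sets (G_carrier B) {U. openin (G_topology B) U}"
      using openin_cyl by (auto simp: cylinders_def intro!: sigma_sets.Basic)
  qed
  then show ?thesis
    unfolding Borel_algebra_def topspace_G_topology by (simp add: sets_measure_of[OF sub])
qed

lemma space_Borel_G: "space (Borel_algebra (G_topology B)) = G_carrier B"
  unfolding Borel_algebra_def topspace_G_topology by (simp add: space_measure_of_conv)

lemma cylinders_sub: "cylinders B \<subseteq> Pow (G_carrier B)"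
  by (auto simp: cylinders_def cyl_def)

lemma cyl_in_Borel: "0 \<notin> B \<Longrightarrow> cyl B K n \<in> sets (Borel_algebra (G_topology B))"
  by (simp add: sets_Borel_G cyl_in_cylinders sigma_sets.Basic)

lemma measure_eq_on_cylinders:
  assumes B: "0 \<notin> B" and P: "prob_space P"
    and sets: "sets P = sets (Borel_algebra (G_topology B))" "sets Q = sets (Borel_algebra (G_topology B))"
    and eq: "\<And>K n. emeasure P (cyl B K n) = emeasure Q (cyl B K n)"
  shows "P = Q"
proof (rule measure_eqI_generator_eq[where A = "\<lambda>_. G_carrier B"])
  show "Int_stable (cylinders B)" by (rule Int_stable_cylinders)
  show "cylinders B \<subseteq> Pow (G_carrier B)" by (rule cylinders_sub)
  show "emeasure P X = emeasure Q X" if "X \<in> cylinders B" for X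
    using that eq by (auto simp: cylinders_def)
  show "sets P = sigma_sets (G_carrier B) (cylinders B)" "sets Q = sigma_sets (G_carrier B) (cylinders B)"
    using sets sets_Borel_G[OF B] by auto
  show "range (\<lambda>_. G_carrier B) \<subseteq> cylinders B"
    using cyl_in_cylinders[of B 0 0] cyl_0[OF B] by auto
  have "emeasure P (G_carrier B) = 1"
    using prob_space.emeasure_space_1[OF P] sets_eq_imp_space_eq[OF sets(1)] by (simp add: space_Borel_G)
  then show "emeasure P (G_carrier B) \<noteq> \<infinity>" by simp
qed auto

section \<open>The Haar measure\<close>

lemma finite_cyl_level:
  assumes "0 \<notin> B" shows "finite (range (cyl B K))"
proof -
  have eq: "cyl B K n = cyl B K (n mod fact K)" for n
  proof -
    have "n mod fact K mod int b = n mod int b" if "b \<in> B" "b \<le> K" for b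
    proof -
      have "b > 0" using assms that(1) by (auto intro: gr0I)
      then have "b dvd fact K" using that(2) by (simp add: dvd_fact)
      then have "int b dvd fact K" by (metis of_nat_dvd_iff of_nat_fact)
      then show ?thesis by (rule mod_mod_cancel)
    qed
    then show ?thesis by (auto simp: cyl_def agree_def)
  qed
  have "range (cyl B K) \<subseteq> cyl B K ` {0..<fact K}"
  proof (rule image_subsetI)
    fix n
    show "cyl B K n \<in> cyl B K ` {0..<fact K}"
      using imageI[of "n mod fact K" "{0..<fact K}" "cyl B K"] unfolding eq[symmetric] by simp
  qed
  then show ?thesis by (rule finite_subset) simp
qed

text \<open>
  The cylinders of level \<open>K\<close> partition the group and are translates of each other by residue sequences of
  integers, so their equal measures add up to 1.
\<close>

lemma Haar_cyl:
  assumes B: "0 \<notin> B" and P: "is_normalized_Haar (G_group B) (G_topology B) P"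
  shows "of_nat (card (range (cyl B K))) * emeasure P (cyl B K n) = 1"
proof -
  interpret prob_space P using P by (simp add: is_normalized_Haar_def)
  have setsP: "sets P = sets (Borel_algebra (G_topology B))"
    using P by (simp add: is_normalized_Haar_def)
  then have [measurable]: "cyl B K m \<in> sets P" for m
    using cyl_in_Borel[OF B] by simp
  have eq: "emeasure P (cyl B K m) = emeasure P (cyl B K n)" for m
  proof -
    have g: "residues B (n - m) \<in> G_carrier B" by (rule residues_in_G[OF B])
    have "add_residues B (residues B (n - m)) ` cyl B K m
        = {x \<in> G_carrier B. add_residues B (neg_residues B (residues B (n - m))) x \<in> cyl B K m}"
      by (rule image_add_residues[OF B g]) (auto simp: cyl_def)
    also have "\<dots> = cyl B K (m - - (n - m))"
      by (intro vimage_add_cyl B neg_residues_in_G g agree_neg agree_residues)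
    finally have im: "add_residues B (residues B (n - m)) ` cyl B K m = cyl B K n" by simp
    have "emeasure P ((\<lambda>x. residues B (n - m) \<otimes>\<^bsub>G_group B\<^esub> x) ` cyl B K m) = emeasure P (cyl B K m)"
      using P[unfolded is_normalized_Haar_def carrier_G_group, THEN conjunct2, THEN conjunct2,
          THEN bspec, OF g, THEN bspec] by simp
    then show ?thesis by (simp add: mult_G_group im)
  qed
  have "G_carrier B = \<Union>(range (cyl B K))"
    using G_carrier_iff[OF B] by (auto simp: cyl_def)
  then have "1 = emeasure P (\<Union>D\<in>range (cyl B K). D)"
    using emeasure_space_1 sets_eq_imp_space_eq[OF setsP] by (simp add: space_Borel_G)
  also have "\<dots> = (\<Sum>D\<in>range (cyl B K). emeasure P D)"
    using cyl_Int_same[of B K]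
    by (intro sum_emeasure[symmetric] finite_cyl_level[OF B]) (fastforce simp: disjoint_family_on_def)+
  also have "\<dots> = (\<Sum>D\<in>range (cyl B K). emeasure P (cyl B K n))"
    using eq by (intro sum.cong) auto
  finally show ?thesis by simp
qed

text \<open>
  Together with existence, this determines the definite description in \<^const>\<open>normalized_Haar\<close>.
\<close>

lemma Haar_unique:
  assumes B: "0 \<notin> B" and P: "is_normalized_Haar (G_group B) (G_topology B) P"
    and Q: "is_normalized_Haar (G_group B) (G_topology B) Q"
  shows "P = Q"
proof (rule measure_eq_on_cylinders[OF B])
  fix K n
  have "of_nat (card (range (cyl B K))) * emeasure P (cyl B K n)
      = of_nat (card (range (cyl B K))) * emeasure Q (cyl B K n)"
    by (simp add: Haar_cyl[OF B P] Haar_cyl[OF B Q])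
  moreover have "card (range (cyl B K)) \<noteq> 0"
    using finite_cyl_level[OF B] by simp
  ultimately show "emeasure P (cyl B K n) = emeasure Q (cyl B K n)"
    by (simp add: ennreal_mult_cancel_left)
qed (use P Q in \<open>auto simp: is_normalized_Haar_def\<close>)

text \<open>
  The residues of the profinite integer with digits \<open>w\<close>.
\<close>

definition odometer_point :: "nat set \<Rightarrow> (nat \<Rightarrow> nat) \<Rightarrow> nat \<Rightarrow> int" where
  "odometer_point B w = (\<lambda>b\<in>B. int (trunc b w) mod int b)"

lemma agree_odometer_point:
  assumes "0 \<notin> B"
  shows "agree B K n (odometer_point B w) \<longleftrightarrow> agree B K n (residues B (int (trunc K w)))"
proof -
  have "int (trunc b w) mod int b = int (trunc K w) mod int b" if "b \<in> B" "b \<le> K" for b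
    using trunc_mod_eq[of b K w] mem_pos[OF assms that(1)] that by simp
  then show ?thesis by (auto simp: agree_def odometer_point_def)
qed

lemma odometer_point_in_G:
  assumes "0 \<notin> B"
  shows "odometer_point B w \<in> G_carrier B"
proof -
  have "odometer_point B w \<in> topspace (residue_topology B)"
    using assms
    by (auto simp: odometer_point_def topspace_residue_topology carrier_integer_mod_group intro!: gr0I)
  then show ?thesis
    unfolding G_carrier_iff[OF assms] agree_odometer_point[OF assms] using agree_residues by blast
qed

lemma measurable_odometer_point:
  assumes B: "0 \<notin> B"
  shows "odometer_point B \<in> measurable digits (Borel_algebra (G_topology B))"
proof (rule measurable_sigma_sets[OF sets_Borel_G[OF B] cylinders_sub])
  show "odometer_point B \<in> space digits \<rightarrow> G_carrier B"
    using odometer_point_in_G[OF B] by simp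
  fix D assume "D \<in> cylinders B"
  then consider "D = {}" | K n where "D = cyl B K n" by (auto simp: cylinders_def)
  then show "odometer_point B -` D \<inter> space digits \<in> sets digits"
  proof cases
    case 2
    have "odometer_point B -` D \<inter> space digits
        = {w \<in> space digits. agree B K n (residues B (int (trunc K w)))}"
      using odometer_point_in_G[OF B] agree_odometer_point[OF B] by (auto simp: 2 cyl_def)
    then show ?thesis using trunc_set by simp
  qed simp
qed

definition odometer_measure :: "nat set \<Rightarrow> (nat \<Rightarrow> int) measure" where
  "odometer_measure B = distr digits (Borel_algebra (G_topology B)) (odometer_point B)"

text \<open>
  A cylinder of level \<open>K\<close> corresponds to a residue class of integers, and a change of \<open>n\<close> translates that
  class, which preserves densities.
\<close>

lemma emeasure_odometer_cyl:
  assumes B: "0 \<notin> B"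
  shows "emeasure (odometer_measure B) (cyl B K n) = emeasure (odometer_measure B) (cyl B K m)"
proof -
  interpret prob_space digits by (rule prob_space_digits)
  define S where "S n = {j. agree B K n (residues B j)}" for n
  have cyl_dens: "emeasure (odometer_measure B) (cyl B K n) = mean_density (fact K) (S n)" for n
  proof -
    have "odometer_point B -` cyl B K n \<inter> space digits
        = {w \<in> space digits. int (trunc K w) \<in> S n}"
      using odometer_point_in_G[OF B] agree_odometer_point[OF B] by (auto simp: S_def cyl_def)
    then show ?thesis
      unfolding odometer_measure_def
      by (simp add: emeasure_distr[OF measurable_odometer_point[OF B] cyl_in_Borel[OF B]]
          emeasure_eq_measure prob_trunc)
  qed
  have per: "periodic (fact K) (S n)" for n
    unfolding periodic_def S_def
  proof (intro allI)
    fix j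
    have "(j + int (fact K)) mod int b = j mod int b" if "b \<in> B" "b \<le> K" for b
    proof -
      have "b > 0" using B that(1) by (auto intro: gr0I)
      then have "int b dvd int (fact K)" using that(2) by (simp add: dvd_fact del: of_nat_fact)
      then show ?thesis by (metis mod_add_right_eq dvd_eq_mod_eq_0 add_0_right)
    qed
    then show "j + int (fact K) \<in> {j. agree B K n (residues B j)} \<longleftrightarrow> j \<in> {j. agree B K n (residues B j)}"
      by (simp add: agree_def)
  qed
  have "S m = {j. (n - m) + 1 * j \<in> S n}"
  proof -
    have "agree B K m (residues B j) \<longleftrightarrow> agree B K n (residues B ((n - m) + 1 * j))" for j
    proof -
      have "m mod int b = j mod int b \<longleftrightarrow> n mod int b = ((n - m) + 1 * j) mod int b" for b
        by (simp add: mod_eq_dvd_iff algebra_simps)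
      then show ?thesis by (simp add: agree_def) metis
    qed
    then show ?thesis by (simp add: S_def)
  qed
  then have "mean_density (fact K) (S m) = mean_density (fact K) (S n)"
    using mean_density_affine[OF per, where M = 1 and a = "n - m"] by simp
  then show ?thesis by (simp add: cyl_dens)
qed

lemma measurable_add_residues:
  assumes B: "0 \<notin> B" and g: "g \<in> G_carrier B"
  shows "add_residues B g \<in> measurable (Borel_algebra (G_topology B)) (Borel_algebra (G_topology B))"
proof (rule measurable_sigma_sets[OF sets_Borel_G[OF B] cylinders_sub])
  show "add_residues B g \<in> space (Borel_algebra (G_topology B)) \<rightarrow> G_carrier B"
    using add_residues_in_G[OF B g] by (simp add: space_Borel_G)
  fix D assume "D \<in> cylinders B"
  then consider "D = {}" | K n where "D = cyl B K n" by (auto simp: cylinders_def)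
  then show "add_residues B g -` D \<inter> space (Borel_algebra (G_topology B)) \<in> sets (Borel_algebra (G_topology B))"
  proof cases
    case 2
    obtain m where "agree B K m g" using g G_carrier_iff[OF B] by blast
    from vimage_add_cyl[OF B g this, of n]
    have "add_residues B g -` D \<inter> space (Borel_algebra (G_topology B)) = cyl B K (n - m)"
      by (auto simp: 2 space_Borel_G)
    then show ?thesis using cyl_in_Borel[OF B] by simp
  qed simp
qed

lemma odometer_measure_is_Haar:
  assumes B: "0 \<notin> B"
  shows "is_normalized_Haar (G_group B) (G_topology B) (odometer_measure B)"
  unfolding is_normalized_Haar_def
proof (intro conjI ballI)
  let ?P = "odometer_measure B" and ?M = "Borel_algebra (G_topology B)"
  show prob: "prob_space ?P"
    unfolding odometer_measure_def
    by (intro prob_space.prob_space_distr prob_space_digits measurable_odometer_point B)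
  show setsP: "sets ?P = sets ?M" by (simp add: odometer_measure_def)
  fix g A assume g: "g \<in> carrier (G_group B)" and A: "A \<in> sets ?P"
  then have g: "g \<in> G_carrier B" by (simp add: carrier_G_group)
  let ?h = "add_residues B (neg_residues B g)"
  have nG: "neg_residues B g \<in> G_carrier B" by (rule neg_residues_in_G[OF B g])
  have meas: "?h \<in> measurable ?P ?M"
    using measurable_add_residues[OF B nG] measurable_cong_sets[OF setsP refl] by blast
  have spP: "space ?P = G_carrier B"
    using sets_eq_imp_space_eq[OF setsP] by (simp add: space_Borel_G)
  \<comment> \<open>Translation by the inverse of \<open>g\<close> preserves the measure of cylinders, hence the measure.\<close>
  have "?P = distr ?P ?M ?h"
  proof (rule measure_eq_on_cylinders[OF B prob setsP])
    fix K n
    obtain m where "agree B K m (neg_residues B g)" using nG G_carrier_iff[OF B] by blast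
    from vimage_add_cyl[OF B nG this, of n]
    have "?h -` cyl B K n \<inter> space ?P = cyl B K (n - m)" by (auto simp: spP)
    then show "emeasure ?P (cyl B K n) = emeasure (distr ?P ?M ?h) (cyl B K n)"
      using emeasure_odometer_cyl[OF B]
      by (simp add: emeasure_distr[OF meas cyl_in_Borel[OF B]])
  qed simp
  then have "emeasure ?P A = emeasure (distr ?P ?M ?h) A" by simp
  also have "\<dots> = emeasure ?P (?h -` A \<inter> space ?P)"
    using A setsP by (simp add: emeasure_distr[OF meas])
  also have "?h -` A \<inter> space ?P = add_residues B g ` A"
    using image_add_residues[OF B g, of A] sets.sets_into_space[OF A] by (auto simp: spP)
  finally show "emeasure ?P ((\<lambda>x. g \<otimes>\<^bsub>G_group B\<^esub> x) ` A) = emeasure ?P A"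
    by (simp add: mult_G_group)
qed

lemma normalized_Haar_eq:
  "0 \<notin> B \<Longrightarrow> normalized_Haar (G_group B) (G_topology B) = odometer_measure B"
  unfolding normalized_Haar_def
  by (rule the_equality) (blast intro: Haar_unique odometer_measure_is_Haar)+

section \<open>The Mirsky measure\<close>

text \<open>
  The sequence \<open>eta B\<close> as seen from the profinite integer with digits \<open>w\<close>: since \<open>trunc b w\<close> has its residue
  modulo \<open>b\<close>, position \<open>n\<close> is \<open>False\<close> when some \<open>b\<in>B\<close> divides the integer translated by \<open>n\<close>.
\<close>

definition odometer_sequence :: "nat set \<Rightarrow> (nat \<Rightarrow> nat) \<Rightarrow> int \<Rightarrow> bool" where
  "odometer_sequence B w n \<longleftrightarrow> (\<forall>b\<in>B. \<not> int b dvd n + int (trunc b w))"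

lemma phi_odometer_point: "phi B (odometer_point B w) = odometer_sequence B w"
proof -
  have "n mod int b = (- (int (trunc b w) mod int b)) mod int b \<longleftrightarrow> int b dvd n + int (trunc b w)" for n b
    by (simp add: mod_minus_eq mod_eq_dvd_iff)
  then show ?thesis by (auto simp: phi_def odometer_sequence_def odometer_point_def fun_eq_iff)
qed

text \<open>
  Needed to check measurability of maps into 0-1 sequences one coordinate at a time.
\<close>

instance bool :: second_countable_topology
proof
  show "\<exists>T :: bool set set. countable T \<and> open = generate_topology T"
    by (intro exI[of _ UNIV]) (auto simp: fun_eq_iff Topological_Spaces.open_discrete intro: generate_topology.Basis)
qed

lemma measurable_phi:
  assumes B: "0 \<notin> B"
  shows "phi B \<in> borel_measurable (Borel_algebra (G_topology B))"
proof (rule measurable_coordinatewise_then_product)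
  fix n :: int
  let ?M = "Borel_algebra (G_topology B)"
  have hit: "{g \<in> space ?M. n mod int b = (- g b) mod int b} \<in> sets ?M" if b: "b \<in> B" for b
  proof -
    let ?I = "{m. int b dvd n + m}"
    have "{g \<in> space ?M. n mod int b = (- g b) mod int b} = (\<Union>m\<in>?I. cyl B b m)"
    proof (intro equalityI subsetI)
      fix g assume "g \<in> {g \<in> space ?M. n mod int b = (- g b) mod int b}"
      then have g: "g \<in> G_carrier B" "n mod int b = (- g b) mod int b" by (auto simp: space_Borel_G)
      obtain m where m: "agree B b m g" using g G_carrier_iff[OF B] by blast
      then have "g b = m mod int b" using b by (simp add: agree_def)
      with g have "int b dvd n + m" by (simp add: mod_minus_eq mod_eq_dvd_iff)
      then show "g \<in> (\<Union>m\<in>?I. cyl B b m)" using g m by (auto simp: cyl_def)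
    next
      fix g assume "g \<in> (\<Union>m\<in>?I. cyl B b m)"
      then obtain m where "int b dvd n + m" "g \<in> G_carrier B" "agree B b m g" by (auto simp: cyl_def)
      moreover from this have "g b = m mod int b" using b by (simp add: agree_def)
      ultimately show "g \<in> {g \<in> space ?M. n mod int b = (- g b) mod int b}"
        by (simp add: mod_minus_eq mod_eq_dvd_iff space_Borel_G dvd_eq_mod_eq_0 mod_add_right_eq)
    qed
    then show ?thesis using cyl_in_Borel[OF B] by auto
  qed
  have "{g \<in> space ?M. phi B g n}
      = space ?M - (\<Union>b\<in>B. {g \<in> space ?M. n mod int b = (- g b) mod int b})"
    by (auto simp: phi_def)
  moreover have "(\<Union>b\<in>B. {g \<in> space ?M. n mod int b = (- g b) mod int b}) \<in> sets ?M"
    by (rule sets.countable_UN') (use hit in auto)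
  ultimately have "{g \<in> space ?M. phi B g n} \<in> sets ?M" by auto
  then have "(\<lambda>g. phi B g n) \<in> measurable ?M (count_space UNIV)"
    by (simp add: pred_def)
  also have "measurable ?M (count_space UNIV) = measurable ?M (borel :: bool measure)"
    by (rule measurable_cong_sets) (simp_all add: sets_borel_eq_count_space)
  finally show "(\<lambda>g. phi B g n) \<in> borel_measurable ?M" .
qed

lemma Mirsky_measure_eq:
  assumes B: "0 \<notin> B"
  shows "Mirsky_measure B = distr digits borel (odometer_sequence B)"
    and "odometer_sequence B \<in> borel_measurable digits"
proof -
  have comp: "phi B \<circ> odometer_point B = odometer_sequence B"
    by (simp add: fun_eq_iff phi_odometer_point)
  show "Mirsky_measure B = distr digits borel (odometer_sequence B)"
    unfolding Mirsky_measure_def normalized_Haar_eq[OF B] odometer_measure_def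
    by (simp add: distr_distr[OF measurable_phi[OF B] measurable_odometer_point[OF B]] comp)
  show "odometer_sequence B \<in> borel_measurable digits"
    using measurable_comp[OF measurable_odometer_point[OF B] measurable_phi[OF B]] comp by simp
qed

section \<open>Patterns, the orbit closure and the support\<close>

text \<open>
  Sets prescribing a finite pattern are a neighbourhood base for 0-1 sequences.
\<close>

lemma open_contains_pattern:
  fixes x :: "int \<Rightarrow> bool"
  assumes "open U" "x \<in> U"
  obtains I where "finite I" "{z. \<forall>i\<in>I. z i = x i} \<subseteq> U"
proof -
  obtain X where X: "x \<in> (\<Pi>\<^sub>E i\<in>UNIV. X i)" "finite {i. X i \<noteq> UNIV}" "(\<Pi>\<^sub>E i\<in>UNIV. X i) \<subseteq> U"
    using product_topology_open_contains_basis[OF assms(1)[unfolded open_fun_def] assms(2)] by auto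
  show ?thesis
  proof (rule that[OF X(2)], rule subsetI)
    fix z assume z: "z \<in> {z. \<forall>i\<in>{i. X i \<noteq> UNIV}. z i = x i}"
    have "z i \<in> X i" for i
      using z PiE_mem[OF X(1), of i] by (cases "X i = UNIV") auto
    then show "z \<in> U" using X(3) by (auto simp: PiE_iff)
  qed
qed

lemma open_pattern:
  fixes x :: "int \<Rightarrow> bool"
  assumes "finite I"
  shows "open {z. \<forall>i\<in>I. z i = x i}"
  using product_topology_basis'[OF assms, of "\<lambda>i. {x i}" "\<lambda>i. i"]
  by (simp add: Topological_Spaces.open_discrete)

lemma closure_iff_pattern:
  fixes x :: "int \<Rightarrow> bool"
  shows "x \<in> closure S \<longleftrightarrow> (\<forall>I. finite I \<longrightarrow> (\<exists>z\<in>S. \<forall>i\<in>I. z i = x i))"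
proof (intro iffI allI impI)
  fix I :: "int set" assume x: "x \<in> closure S" and I: "finite I"
  show "\<exists>z\<in>S. \<forall>i\<in>I. z i = x i"
    using open_Int_closure_eq_empty[OF open_pattern[OF I, of x], of S] x by auto
next
  assume pat: "\<forall>I. finite I \<longrightarrow> (\<exists>z\<in>S. \<forall>i\<in>I. z i = x i)"
  show "x \<in> closure S"
  proof (rule ccontr)
    assume "x \<notin> closure S"
    then have "open (- closure S)" "x \<in> - closure S" by (simp_all add: open_Compl)
    then obtain I where I: "finite I" "{z. \<forall>i\<in>I. z i = x i} \<subseteq> - closure S"
      by (rule open_contains_pattern)
    from pat I(1) obtain z where "z \<in> S" "\<forall>i\<in>I. z i = x i" by blast
    with I(2) closure_subset[of S] show False by blast
  qed
qed

lemma eta_iff: "eta B n \<longleftrightarrow> (\<forall>b\<in>B. \<not> int b dvd n)"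
  by (auto simp: eta_def B_free_def multiples_def)

lemma X_eta_iff_pattern:
  "x \<in> X_eta B \<longleftrightarrow> (\<forall>I. finite I \<longrightarrow> (\<exists>m. \<forall>i\<in>I. x i = eta B (i + m)))"
proof -
  have "(\<exists>z\<in>{shift_power m (eta B) | m. True}. \<forall>i\<in>I. z i = x i)
      \<longleftrightarrow> (\<exists>m. \<forall>i\<in>I. x i = eta B (i + m))" for I
    by (auto simp: shift_power_def)
  then show ?thesis unfolding X_eta_def closure_iff_pattern by simp
qed

lemma support_iff_pattern:
  assumes B: "0 \<notin> B"
  shows "x \<in> topological_support (Mirsky_measure B) \<longleftrightarrow>
    (\<forall>I. finite I \<longrightarrow> measure digits {w \<in> space digits. \<forall>i\<in>I. odometer_sequence B w i = x i} > 0)"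
proof -
  interpret prob_space digits by (rule prob_space_digits)
  have meas: "odometer_sequence B \<in> borel_measurable digits" by (rule Mirsky_measure_eq(2)[OF B])
  have em: "emeasure (Mirsky_measure B) U = measure digits {w \<in> space digits. odometer_sequence B w \<in> U}"
    if "open U" for U
    using that meas by (simp add: Mirsky_measure_eq(1)[OF B] emeasure_distr emeasure_eq_measure
        vimage_def Int_def conj_commute)
  show ?thesis
  proof (intro iffI allI impI)
    fix I :: "int set" assume x: "x \<in> topological_support (Mirsky_measure B)" and I: "finite I"
    have "emeasure (Mirsky_measure B) {z. \<forall>i\<in>I. z i = x i} > 0"
      using x open_pattern[OF I, of x] unfolding topological_support_def by blast
    then show "measure digits {w \<in> space digits. \<forall>i\<in>I. odometer_sequence B w i = x i} > 0"
      using em[OF open_pattern[OF I, of x]] by simp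
  next
    assume pat: "\<forall>I. finite I \<longrightarrow> measure digits {w \<in> space digits. \<forall>i\<in>I. odometer_sequence B w i = x i} > 0"
    show "x \<in> topological_support (Mirsky_measure B)"
      unfolding topological_support_def
    proof (intro CollectI allI impI, elim conjE)
      fix U assume U: "open U" "x \<in> U"
      obtain I where I: "finite I" "{z. \<forall>i\<in>I. z i = x i} \<subseteq> U"
        using open_contains_pattern[OF U] .
      have "0 < measure digits {w \<in> space digits. \<forall>i\<in>I. odometer_sequence B w i = x i}"
        using pat I(1) by blast
      also have "\<dots> \<le> measure digits {w \<in> space digits. odometer_sequence B w \<in> U}"
        using I(2) measurable_sets[OF meas borel_open[OF U(1)]]
        by (intro finite_measure_mono) (auto simp: vimage_def Int_def conj_commute)
      finally show "emeasure (Mirsky_measure B) U > 0" by (simp add: em[OF U(1)])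
    qed
  qed
qed

lemma dvd_add_period: "b dvd R \<Longrightarrow> int b dvd n + int R + i \<longleftrightarrow> int b dvd n + i"
  by (metis add.commute add.left_commute dvd_add_right_iff int_dvd_int_iff)

lemma dvd_trunc_measurable [measurable]:
  "{w \<in> space digits. int b dvd i + int (trunc K w)} \<in> sets digits"
  by measurable

text \<open>
  The event \<open>D k\<close> below says that the profinite integer lies in the progression \<open>m + M * \<int>\<close> and that no
  \<open>b \<le> 2 * y + k\<close> in \<open>B\<close> destroys a one of the pattern. The progression has probability
  \<open>1 / M\<close>, of which at most the fraction \<open>c < 1\<close> is lost, uniformly in \<open>k\<close>; so the intersection of the
  decreasing events \<open>D k\<close> has positive probability, and the pattern is shown on it.
\<close>

lemma eta_patterns_have_positive_measure:
  assumes B: "0 \<notin> B" and light: "light_tails B" and I: "finite I"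
  shows "measure digits {w \<in> space digits. \<forall>i\<in>I. odometer_sequence B w i = eta B (i + m)} > 0"
proof -
  interpret prob_space digits by (rule prob_space_digits)
  define J where "J = {i \<in> I. eta B (i + m)}"
  have J: "finite J" using I by (simp add: J_def)
  obtain A where A: "\<And>i. i \<in> J \<Longrightarrow> \<bar>i + m\<bar> \<le> int A"
  proof -
    have "\<bar>i + m\<bar> \<le> int (\<Sum>i\<in>J. nat \<bar>i + m\<bar>)" if "i \<in> J" for i
      using member_le_sum[OF that, of "\<lambda>i. nat \<bar>i + m\<bar>"] J by linarith
    then show ?thesis by (rule that)
  qed
  obtain L where L: "\<And>i. i \<in> I \<Longrightarrow> \<not> eta B (i + m) \<Longrightarrow> \<exists>b\<in>B. b \<le> L \<and> int b dvd i + m"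
  proof -
    have "\<forall>i\<in>I - J. \<exists>b. b \<in> B \<and> int b dvd i + m" by (auto simp: J_def eta_iff)
    then obtain f where f: "\<forall>i\<in>I - J. f i \<in> B \<and> int (f i) dvd i + m" by metis
    have "f i \<le> Max (f ` (I - J))" if "i \<in> I - J" for i using that I by (intro Max_ge) auto
    then have "\<exists>b\<in>B. b \<le> Max (f ` (I - J)) \<and> int b dvd i + m" if "i \<in> I" "\<not> eta B (i + m)" for i
      using f that by (intro bexI[of _ "f i"]) (auto simp: J_def)
    then show ?thesis by (rule that)
  qed
  \<comment> \<open>The choice of \<open>e\<close> makes the total loss \<open>c\<close>, summed over all ones of the pattern, less than 1;
    it depends only on the pattern and not on \<open>y\<close>.\<close>
  define e :: real where "e = 1 / ((real (card J) + 1) * (real A * real A + 1))"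
  have e: "e > 0" unfolding e_def by (intro divide_pos_pos mult_pos_pos add_nonneg_pos) auto
  define c where "c = real (card J) * (real A * real A * e)"
  have c1: "c < 1"
  proof -
    have "real (card J) * (real A * real A) < (real (card J) + 1) * (real A * real A + 1)"
      by (simp add: algebra_simps) (smt (verit) of_nat_0_le_iff mult_nonneg_nonneg)
    then show ?thesis
      unfolding c_def e_def by (simp add: divide_less_eq_1 add_nonneg_pos mult_pos_pos)
  qed
  obtain K0 where K0: "\<forall>\<^sub>F N in sequentially. real (card (tail_multiples B K0 \<inter> {1..int N})) \<le> e * real N"
    using light_tails_eventually[OF light e] .
  \<comment> \<open>Beyond \<open>K0\<close> the tail is light, \<open>A\<close> bounds the positions of the ones, and every zero is witnessed
    by a divisor up to \<open>L\<close>.\<close>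
  define y where "y = max K0 (max A L)"
  have tail: "\<forall>\<^sub>F N in sequentially. real (card (tail_multiples B y \<inter> {1..int N})) \<le> e * real N"
  proof (rule eventually_mono[OF K0])
    fix N assume le: "real (card (tail_multiples B K0 \<inter> {1..int N})) \<le> e * real N"
    have "card (tail_multiples B y \<inter> {1..int N}) \<le> card (tail_multiples B K0 \<inter> {1..int N})"
      using tail_multiples_antimono[of K0 y B] by (intro card_mono) (auto simp: y_def)
    with le show "real (card (tail_multiples B y \<inter> {1..int N})) \<le> e * real N" by linarith
  qed
  define M :: nat where "M = (fact y)\<^sup>2"
  have M0: "M > 0" by (simp add: M_def)
  \<comment> \<open>Hence \<open>2 * y\<close> digits determine the residue modulo \<open>M\<close>.\<close>
  have M_dvd: "M dvd fact (2 * y + k)" for k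
  proof -
    have "M dvd fact (y + y)"
      unfolding M_def power2_eq_square by (rule fact_fact_dvd_fact)
    also have "(fact (y + y) :: nat) dvd fact (2 * y + k)" by (rule fact_dvd) simp
    finally show ?thesis .
  qed
  define S0 where "S0 = {n. int M dvd n + (- m)}"
  define T where "T K = {b \<in> B. b \<le> K}" for K
  define S where "S K = {n \<in> S0. \<exists>i\<in>J. \<exists>b\<in>T K. int b dvd n + i}" for K
  define D where "D k = {w \<in> space digits. int (trunc (2 * y + k) w) \<in> S0 - S (2 * y + k)}" for k
  have T_dvd: "b dvd fact K" if "b \<in> T K" for b K
    using that mem_pos[OF B, of b] by (auto simp: T_def intro!: dvd_fact)
  have prob_D: "(1 - c) / real M \<le> measure digits (D k)" for k
  proof -
    define K where "K = 2 * y + k"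
    define H where "H = {k. \<exists>i\<in>J. \<exists>b\<in>T K. int b dvd (i + m) + int M * k}"
    have M_K: "M dvd fact K" using M_dvd by (simp add: K_def)
    have S0_im: "S0 = (\<lambda>k. m + int M * k) ` UNIV"
    proof (intro equalityI subsetI)
      fix n assume "n \<in> S0"
      then obtain k where "n + (- m) = int M * k" by (auto simp: S0_def)
      then show "n \<in> (\<lambda>k. m + int M * k) ` UNIV" by (intro image_eqI[of _ _ k]) auto
    qed (auto simp: S0_def)
    have S_im: "S K = (\<lambda>k. m + int M * k) ` H"
    proof -
      have "(m + int M * k) + i = (i + m) + int M * k" for i k by simp
      moreover have "S K = (\<lambda>k. m + int M * k) ` {k. \<exists>i\<in>J. \<exists>b\<in>T K. int b dvd (m + int M * k) + i}"
        unfolding S_def S0_im by blast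
      ultimately show ?thesis by (simp only: H_def)
    qed
    have perS0: "periodic (fact K) S0"
      by (simp only: periodic_def S0_def mem_Collect_eq dvd_add_period[OF M_K] simp_thms)
    have perS: "periodic (fact K) (S K)"
      using perS0 dvd_add_period[OF T_dvd[of _ K]] unfolding periodic_def S_def by simp
    have "periodic 1 (UNIV :: int set)" by (simp add: periodic_def)
    note prog = mean_density_progression[OF this M0, of m, folded S0_im]
    have "mean_density (fact K) S0 = mean_density (M * 1) S0"
      using perS0 prog(2) M0 by (intro mean_density_period_unique) auto
    also have "\<dots> = 1 / real M"
      using prog(1) by (simp add: mean_density_def)
    finally have dens0: "mean_density (fact K) S0 = 1 / real M" .
    have perH: "periodic (fact K) H"
    proof -
      have "int b dvd (i + m) + int M * (k + int (fact K)) \<longleftrightarrow> int b dvd (i + m) + int M * k"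
        if "b \<in> T K" for b i k
      proof -
        have "int b dvd int M * int (fact K)" using T_dvd[OF that] by (simp del: of_nat_fact)
        then show ?thesis by (simp add: distrib_left flip: add.assoc) (metis add.assoc dvd_add_left_iff)
      qed
      then show ?thesis unfolding periodic_def H_def by simp
    qed
    have "mean_density (fact K) (S K) = mean_density (M * fact K) (S K)"
      using perS periodic_mult[OF perS, of M] M0
      by (intro mean_density_period_unique) (auto simp: mult.commute)
    also have "\<dots> = mean_density (fact K) H / real M"
      unfolding S_im by (rule mean_density_progression(1)[OF perH M0]) simp
    also have "\<dots> \<le> c / real M"
    proof (intro divide_right_mono)
      have "H = (\<Union>i\<in>J. {k. \<exists>b\<in>T K. int b dvd (i + m) + (fact y)\<^sup>2 * k})"
        by (auto simp: H_def M_def)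
      then have "mean_density (fact K) H
          \<le> (\<Sum>i\<in>J. mean_density (fact K) {k. \<exists>b\<in>T K. int b dvd (i + m) + (fact y)\<^sup>2 * k})"
        using mean_density_UN_le[OF J] by simp
      also have "\<dots> \<le> (\<Sum>i\<in>J. real A * real A * e)"
      proof (rule sum_mono)
        fix i assume i: "i \<in> J"
        show "mean_density (fact K) {k. \<exists>b\<in>T K. int b dvd (i + m) + (fact y)\<^sup>2 * k} \<le> real A * real A * e"
        proof (rule mean_density_hit_progression[OF B _ _ _ A[OF i] _ _ _ tail])
          show "\<not> int b dvd i + m" if "b \<in> B" for b
            using i that by (auto simp: J_def eta_iff)
        qed (use T_dvd e in \<open>auto simp: T_def y_def\<close>)
      qed
      also have "\<dots> = c" by (simp add: c_def)
      finally show "mean_density (fact K) H \<le> c" .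
    qed simp
    finally have "(1 - c) / real M \<le> mean_density (fact K) S0 - mean_density (fact K) (S K)"
      by (simp add: dens0 diff_divide_distrib)
    also have "\<dots> = mean_density (fact K) (S0 - S K)"
      by (rule mean_density_diff[symmetric]) (auto simp: S_def)
    also have "\<dots> = measure digits (D k)"
      unfolding D_def K_def[symmetric] by (rule prob_trunc[symmetric])
    finally show ?thesis .
  qed
  have D_iff: "w \<in> D k \<longleftrightarrow> w \<in> space digits \<and> int M dvd int (trunc (2 * y) w) + (- m) \<and>
      (\<forall>i\<in>J. \<forall>b\<in>B. b \<le> 2 * y + k \<longrightarrow> \<not> int b dvd i + int (trunc b w))" for w k
  proof -
    have "trunc (2 * y + k) w mod M = trunc (2 * y) w mod M"
      by (rule trunc_dvd_cong[OF M0]) (use M_dvd[of 0] in simp_all)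
    from arg_cong[OF this, of int]
    have "int M dvd int (trunc (2 * y + k) w) - int (trunc (2 * y) w)"
      by (simp only: of_nat_mod mod_eq_dvd_iff)
    from dvd_add_right_iff[OF this, of "int (trunc (2 * y) w) + (- m)"]
    have "int M dvd int (trunc (2 * y + k) w) + (- m) \<longleftrightarrow> int M dvd int (trunc (2 * y) w) + (- m)"
      by simp
    moreover have "int b dvd int (trunc (2 * y + k) w) + i \<longleftrightarrow> int b dvd i + int (trunc b w)"
      if "b \<in> B" "b \<le> 2 * y + k" for b i
      using trunc_dvd_iff[OF mem_pos[OF B that(1)] that(2), of i w] by (simp add: add.commute)
    ultimately show ?thesis
      unfolding D_def S_def S0_def T_def by auto
  qed
  have "(\<lambda>k. measure digits (D k)) \<longlonglongrightarrow> measure digits (\<Inter>k. D k)"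
  proof (rule finite_Lim_measure_decseq)
    show "range D \<subseteq> sets digits" by (auto simp: D_def)
    show "decseq D" unfolding decseq_def using D_iff by (auto simp: subset_iff)
  qed
  then have "(1 - c) / real M \<le> measure digits (\<Inter>k. D k)"
    by (rule LIMSEQ_le_const) (use prob_D in auto)
  moreover have "(1 - c) / real M > 0" using c1 M0 by simp
  moreover have "measure digits (\<Inter>k. D k)
      \<le> measure digits {w \<in> space digits. \<forall>i\<in>I. odometer_sequence B w i = eta B (i + m)}"
  proof (rule finite_measure_mono)
    show "(\<Inter>k. D k) \<subseteq> {w \<in> space digits. \<forall>i\<in>I. odometer_sequence B w i = eta B (i + m)}"
    proof
      fix w assume "w \<in> (\<Inter>k. D k)"
      then have w: "w \<in> D k" for k by blast
      have "odometer_sequence B w i = eta B (i + m)" if i: "i \<in> I" for i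
      proof (cases "eta B (i + m)")
        case True
        then have "i \<in> J" using i by (simp add: J_def)
        then have "\<not> int b dvd i + int (trunc b w)" if "b \<in> B" for b
          using w[of b] that unfolding D_iff by auto
        then show ?thesis using True by (auto simp: odometer_sequence_def)
      next
        case False
        then obtain b where b: "b \<in> B" "b \<le> L" "int b dvd i + m" using L[OF i] by blast
        have "b dvd fact y" using b mem_pos[OF B b(1)] by (intro dvd_fact) (auto simp: y_def)
        then have "b dvd M" by (simp add: M_def power2_eq_square)
        then have "int b dvd int (trunc (2 * y) w) + (- m)"
          using w[of 0] unfolding D_iff by (meson dvd_trans int_dvd_int_iff)
        from dvd_add[OF b(3) this] have "int b dvd i + int (trunc (2 * y) w)" by simp
        then have "int b dvd i + int (trunc b w)"
          using trunc_dvd_iff[OF mem_pos[OF B b(1)], of "2 * y"] b(2) by (simp add: y_def)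
        then show ?thesis using False b(1) by (auto simp: odometer_sequence_def)
      qed
      then show "w \<in> {w \<in> space digits. \<forall>i\<in>I. odometer_sequence B w i = eta B (i + m)}"
        using w[of 0] by (simp add: D_iff)
    qed
    show "{w \<in> space digits. \<forall>i\<in>I. odometer_sequence B w i = eta B (i + m)} \<in> sets digits"
      using measurable_sets[OF Mirsky_measure_eq(2)[OF B] borel_open[OF open_pattern[OF I, of "\<lambda>i. eta B (i + m)"]]]
      by (simp add: vimage_def Int_def conj_commute)
  qed
  ultimately show ?thesis by linarith
qed

lemma card_shifted_le:
  "card ({n. n + i \<in> V} \<inter> {1..int N}) \<le> card (V \<inter> {1..int N}) + nat \<bar>i\<bar>"
proof -
  let ?E = "if i \<ge> 0 then {int N + 1..int N + i} else {i + 1..0}"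
  have "card ({n. n + i \<in> V} \<inter> {1..int N}) = card ((\<lambda>n. n + i) ` ({n. n + i \<in> V} \<inter> {1..int N}))"
    by (rule card_image[symmetric]) simp
  also have "\<dots> \<le> card ((V \<inter> {1..int N}) \<union> ?E)"
    by (intro card_mono) auto
  also have "\<dots> \<le> card (V \<inter> {1..int N}) + card ?E"
    by (rule card_Un_le)
  also have "card ?E = nat \<bar>i\<bar>" by auto
  finally show ?thesis by simp
qed

text \<open>
  Truncate the zeros of the pattern at a level \<open>K\<close> where more than half of the measure remains: at each
  integer of the resulting periodic set \<open>S\<close> the zeros are correct, and a one can only be wrong because of
  a multiple of some \<open>b > K\<close>. If the pattern never occurred, translates of the tail multiples would cover
  \<open>S\<close>, contradicting their small density.
\<close>

lemma positive_patterns_occur_in_eta: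
  assumes B: "0 \<notin> B" and light: "light_tails B" and I: "finite I"
    and pos: "measure digits {w \<in> space digits. \<forall>i\<in>I. odometer_sequence B w i = x i} > 0"
  shows "\<exists>m. \<forall>i\<in>I. x i = eta B (i + m)"
proof (rule ccontr)
  assume none: "\<nexists>m. \<forall>i\<in>I. x i = eta B (i + m)"
  interpret prob_space digits by (rule prob_space_digits)
  define J where "J = {i \<in> I. x i}"
  have J: "finite J" using I by (simp add: J_def)
  define W where "W = {w \<in> space digits. \<forall>i\<in>I. odometer_sequence B w i = x i}"
  define Z where "Z K = {w \<in> W. \<forall>i\<in>I - J. \<exists>b\<in>B. b \<le> K \<and> int b dvd i + int (trunc b w)}" for K
  have W_sets: "W \<in> sets digits"
    using measurable_sets[OF Mirsky_measure_eq(2)[OF B] borel_open[OF open_pattern[OF I, of x]]]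
    by (simp add: W_def vimage_def Int_def conj_commute)
  have Z_sets: "Z K \<in> sets digits" for K
  proof -
    have "{w \<in> space digits. \<forall>i\<in>I - J. \<exists>b\<in>{b\<in>B. b \<le> K}. int b dvd i + int (trunc b w)} \<in> sets digits"
      using I by (intro sets.sets_Collect_finite_All sets.sets_Collect_finite_Ex dvd_trunc_measurable) auto
    moreover have "Z K = W \<inter> {w \<in> space digits. \<forall>i\<in>I - J. \<exists>b\<in>{b\<in>B. b \<le> K}. int b dvd i + int (trunc b w)}"
      by (auto simp: Z_def W_def)
    ultimately show ?thesis using W_sets by simp
  qed
  have "(\<Union>K. Z K) = W"
  proof (intro equalityI subsetI)
    fix w assume w: "w \<in> W"
    have "\<forall>i\<in>I - J. \<exists>b. b \<in> B \<and> int b dvd i + int (trunc b w)"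
      using w by (auto simp: W_def J_def odometer_sequence_def)
    then obtain f where f: "\<forall>i\<in>I - J. f i \<in> B \<and> int (f i) dvd i + int (trunc (f i) w)" by metis
    have "f i \<le> Max (f ` (I - J))" if "i \<in> I - J" for i using that I by (intro Max_ge) auto
    then have "w \<in> Z (Max (f ` (I - J)))" using w f unfolding Z_def by blast
    then show "w \<in> (\<Union>K. Z K)" by blast
  qed (auto simp: Z_def)
  moreover have "(\<lambda>K. measure digits (Z K)) \<longlonglongrightarrow> measure digits (\<Union>K. Z K)"
  proof (rule finite_Lim_measure_incseq)
    show "incseq Z" unfolding incseq_def Z_def by (auto intro: order_trans)
  qed (use Z_sets in auto)
  ultimately have "\<forall>\<^sub>F K in sequentially. measure digits (Z K) > measure digits W / 2"
    using pos by (intro order_tendstoD(1)) (auto simp: W_def)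
  then obtain K1 where K1: "\<And>K. K \<ge> K1 \<Longrightarrow> measure digits (Z K) > measure digits W / 2"
    by (auto simp: eventually_sequentially)
  define e where "e = measure digits W / (2 * (real (card J) + 1))"
  have e: "e > 0" using pos by (simp add: e_def W_def)
  obtain K0 where K0: "\<forall>\<^sub>F N in sequentially. real (card (tail_multiples B K0 \<inter> {1..int N})) \<le> e * real N"
    using light_tails_eventually[OF light e] .
  define K where "K = max K0 K1"
  define S where "S = {n. (\<forall>i\<in>I - J. \<exists>b\<in>B. b \<le> K \<and> int b dvd n + i) \<and>
      (\<forall>i\<in>J. \<forall>b\<in>B. b \<le> K \<longrightarrow> \<not> int b dvd n + i)}"
  have "int b dvd n + int (fact K) + i \<longleftrightarrow> int b dvd n + i" if "b \<in> B" "b \<le> K" for b n i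
    using mem_pos[OF B that(1)] that(2) by (intro dvd_add_period dvd_fact) auto
  then have perS: "periodic (fact K) S"
    unfolding periodic_def S_def by (simp cong: conj_cong imp_cong del: of_nat_fact)
  have "Z K \<subseteq> {w \<in> space digits. int (trunc K w) \<in> S}"
  proof
    fix w assume w: "w \<in> Z K"
    have "int b dvd int (trunc K w) + i \<longleftrightarrow> int b dvd i + int (trunc b w)" if "b \<in> B" "b \<le> K" for b i
      using trunc_dvd_iff[OF mem_pos[OF B that(1)] that(2), of i w] by (simp add: add.commute)
    moreover have "\<not> int b dvd i + int (trunc b w)" if "i \<in> J" "b \<in> B" for i b
      using w that by (auto simp: Z_def W_def J_def odometer_sequence_def)
    ultimately show "w \<in> {w \<in> space digits. int (trunc K w) \<in> S}"
      using w by (auto simp: Z_def W_def S_def cong: conj_cong)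
  qed
  then have "measure digits (Z K) \<le> measure digits {w \<in> space digits. int (trunc K w) \<in> S}"
    by (intro finite_measure_mono) auto
  also have "\<dots> = mean_density (fact K) S" by (rule prob_trunc)
  finally have lower: "measure digits W / 2 < mean_density (fact K) S"
    using K1[of K] by (simp add: K_def)
  have cover: "S \<subseteq> (\<Union>i\<in>J. {n. n + i \<in> tail_multiples B K0})"
  proof
    fix n assume n: "n \<in> S"
    obtain i where i: "i \<in> I" "x i \<noteq> eta B (i + n)" using none by blast
    show "n \<in> (\<Union>i\<in>J. {n. n + i \<in> tail_multiples B K0})"
    proof (cases "x i")
      case True
      with i obtain b where b: "b \<in> B" "int b dvd n + i" by (auto simp: eta_iff add.commute)
      have "i \<in> J" using i True by (simp add: J_def)
      with n b have "b > K" by (force simp: S_def)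
      with b have "n + i \<in> tail_multiples B K0"
        by (auto simp: tail_multiples_def multiples_def K_def)
      then show ?thesis using \<open>i \<in> J\<close> by blast
    next
      case False
      then have "i \<in> I - J" using i by (simp add: J_def)
      with n obtain b where "b \<in> B" "int b dvd n + i" by (auto simp: S_def)
      then have "\<not> eta B (i + n)" by (auto simp: eta_iff add.commute)
      with False i show ?thesis by simp
    qed
  qed
  have "mean_density (fact K) S \<le> real (card J) * e"
  proof (rule mean_density_le_of_counting[OF perS, where c = "\<Sum>i\<in>J. real (nat \<bar>i\<bar>)"])
    show "\<forall>\<^sub>F N in sequentially. real (card (S \<inter> {1..int N}))
        \<le> real (card J) * e * real N + (\<Sum>i\<in>J. real (nat \<bar>i\<bar>))"
    proof (rule eventually_mono[OF K0])
      fix N assume N: "real (card (tail_multiples B K0 \<inter> {1..int N})) \<le> e * real N"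
      have "card (S \<inter> {1..int N}) \<le> card (\<Union>i\<in>J. {n. n + i \<in> tail_multiples B K0} \<inter> {1..int N})"
        using cover J by (intro card_mono) auto
      also have "\<dots> \<le> (\<Sum>i\<in>J. card ({n. n + i \<in> tail_multiples B K0} \<inter> {1..int N}))"
        by (rule card_UN_le[OF J])
      also have "\<dots> \<le> (\<Sum>i\<in>J. card (tail_multiples B K0 \<inter> {1..int N}) + nat \<bar>i\<bar>)"
        by (intro sum_mono card_shifted_le)
      finally have "real (card (S \<inter> {1..int N}))
          \<le> (\<Sum>i\<in>J. real (card (tail_multiples B K0 \<inter> {1..int N})) + real (nat \<bar>i\<bar>))"
        by (metis (no_types, lifting) of_nat_add of_nat_le_iff of_nat_sum sum.cong)
      also have "\<dots> \<le> (\<Sum>i\<in>J. e * real N + real (nat \<bar>i\<bar>))"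
        using N by (intro sum_mono) simp
      finally show "real (card (S \<inter> {1..int N}))
          \<le> real (card J) * e * real N + (\<Sum>i\<in>J. real (nat \<bar>i\<bar>))"
        by (simp add: sum.distrib)
    qed
  qed simp
  also have "\<dots> \<le> measure digits W / 2"
  proof -
    have "real (card J) * e \<le> (real (card J) + 1) * e" using e by simp
    also have "\<dots> = measure digits W / 2" by (simp add: e_def field_simps)
    finally show ?thesis .
  qed
  finally show False using lower by simp
qed

theorem theorem7:
  fixes B :: "nat set"
  assumes "0 \<notin> B"
    and "light_tails B"
  shows "X_eta B = topological_support (Mirsky_measure B)"
proof (intro equalityI subsetI)
  fix x assume x: "x \<in> X_eta B"
  show "x \<in> topological_support (Mirsky_measure B)"
    unfolding support_iff_pattern[OF assms(1)]
  proof (intro allI impI)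
    fix I :: "int set" assume I: "finite I"
    obtain m where "\<forall>i\<in>I. x i = eta B (i + m)"
      using x I unfolding X_eta_iff_pattern by blast
    then show "measure digits {w \<in> space digits. \<forall>i\<in>I. odometer_sequence B w i = x i} > 0"
      using eta_patterns_have_positive_measure[OF assms I, of m] by simp
  qed
next
  fix x assume x: "x \<in> topological_support (Mirsky_measure B)"
  then show "x \<in> X_eta B"
    unfolding support_iff_pattern[OF assms(1)] X_eta_iff_pattern
    using positive_patterns_occur_in_eta[OF assms] by blast
qed

end
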